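(* Let $n\in\mathbb{N}$, $n\ge1$, and let $X$ be a Banach two-sided $\mathbb{R}_n$-module. Let $\mathsf{T}:[0,\infty)\to\mathscr{L}^r(X)$ be a strongly continuous right linear semigroup, let $\mathsf{A}:D(\mathsf{A})\to X$ be its generator, and let $\omega\in\mathbb{R}$ be such that $M:=\sup_{t\in[0,\infty)}\|\mathsf{T}(t)\|e^{-\omega t}<\infty$. Let $q\in Q_{\mathbb{R}_n}$, set $a:=\mathrm{Re}(q)$ and $b:=|\mathrm{Im}(q)|$, and let $g_q(t):=te^{-at}\,\mathrm{sinc}(tb)$ for $t\in\mathbb{R}$. If $\mathrm{Re}(q)>\omega$, then $q\in\rho_{S}(\mathsf{A})$ and, for every $x\in X$, $$\mathsf{Q}_q(\mathsf{A})x=\int_0^\infty\mathsf{T}(t)g_q(t)x\,dt=\int_0^\infty\mathsf{T}(t)te^{-ta}\,\mathrm{sinc}(tb)x\,dt,$$ $$\mathsf{A}\mathsf{Q}_q(\mathsf{A})x=-\int_0^\infty\mathsf{T}(t)g_q'(t)x\,dt=-\int_0^\infty\mathsf{T}(t)e^{-ta}\big(\cos(tb)-at\,\mathrm{sinc}(tb)\big)x\,dt,$$ $$\mathsf{C}_q(\mathsf{A})x=\int_0^\infty\mathsf{T}(t)e^{-tq}x\,dt.$$ Moreover $$\|\mathsf{Q}_q(\mathsf{A})\|\le\frac{M}{(\mathrm{Re}(q)-\omega)^2},\qquad \|\mathsf{C}_q(\mathsf{A})\|\le\frac{M}{\mathrm{Re}(q)-\omega}.$$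
   Context: $\mathbb{R}_n$ is the Clifford algebra $C\ell(0,n)$: the associative unital real algebra of dimension $2^n$ with basis $\{e_K\}_{K\subseteq\{1,\dots,n\}}$, $e_\varnothing=1$, $e_k:=e_{\{k\}}$ with $e_k^2=-1$, $e_ke_l=-e_le_k$ for $k\ne l$, and $e_K=e_{k_1}\cdots e_{k_s}$ if $K=\{k_1<\dots<k_s\}$. It is equipped with the Clifford conjugation $q^c=\overline{q}=\sum_K(-1)^{|K|(|K|+1)/2}a_Ke_K$ for $q=\sum_K a_Ke_K$ ($a_K\in\mathbb{R}$) and with the Clifford operator norm $|q|:=\sup\{|qa|_{2^n}: |a|_{2^n}=1\}$, where $|\cdot|_{2^n}$ is the Euclidean norm of $\mathbb{R}^{2^n}$. $\mathbb{R}$ is identified with $\mathbb{R}1\subset\mathbb{R}_n$. Let $\mathbb{A}=\mathbb{R}_n$. Put $\mathbb{S}_{\mathbb{A}}:=\{q\in\mathbb{A}: q^c=-q,\ q^2=-1\}$, $\mathbb{C}_{\mathbf{j}}:=\{r+s\mathbf{j}: r,s\in\mathbb{R}\}$ for $\mathbf{j}\in\mathbb{S}_{\mathbb{A}}$; the quadratic cone is $Q_{\mathbb{A}}:=\bigcup_{\mathbf{j}\in\mathbb{S}_{\mathbb{A}}}\mathbb{C}_{\mathbf{j}}$. $\mathrm{Re}(q):=(q+q^c)/2$, $\mathrm{Im}(q):=(q-q^c)/2$; for $q\in Q_{\mathbb{A}}$, $\mathrm{Re}(q)\in\mathbb{R}$ and $|q|^2=qq^c$. $e^{-tq}:=\sum_{k\ge0}(-tq)^k/k!$.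 $\mathrm{sinc}:\mathbb{R}\to\mathbb{R}$ is $\mathrm{sinc}(0)=1$, $\mathrm{sinc}(r)=\sin(r)/r$ for $r\ne0$. A two-sided $\mathbb{A}$-module $X$ is a commutative group $(X,+)$ with left and right scalar multiplications by $\mathbb{A}$, each distributive in both arguments, with $1x=x=x1$, $p(qx)=(pq)x$, $(xp)q=x(pq)$, $p(xq)=(px)q$ for $p,q\in\mathbb{A}$, and $rx=xr$ for $r\in\mathbb{R}$. It is a Banach two-sided $\mathbb{A}$-module if it has a function $\|\cdot\|:X\to[0,\infty)$ with $\|x\|=0\iff x=0$, $\|x+y\|\le\|x\|+\|y\|$, $\|qx\|\le|q|\|x\|$, $\|xq\|\le|q|\|x\|$, and the metric $\|x-y\|$ is complete. In particular $X$ is a real Banach space, and $X$-valued integrals are Lebesgue (Bochner) integrals in it. A right linear operator is an additive map $\mathsf{A}:D(\mathsf{A})\to X$, where $D(\mathsf{A})\subseteq X$ is a right $\mathbb{A}$-submodule (an additive subgroup closed under right multiplication by $\mathbb{A}$), with $\mathsf{A}(xq)=\mathsf{A}(x)q$. $\mathscr{L}^r(X)$ is the set of right linear $\mathsf{B}:X\to X$ with $\|\mathsf{B}\|:=\sup_{x\ne0}\|\mathsf{B}x\|/\|x\|<\infty$. For $\mathsf{B}$ right linear on $X$ and $p\in\mathbb{A}$, $\mathsf{B}p$ is the operator $(\mathsf{B}p)(x):=\mathsf{B}(px)$. $D(\mathsf{A}^2)=\{x\in D(\mathsf{A}):\mathsf{A}x\in D(\mathsf{A})\}$. A strongly continuous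 right linear semigroup is a map $\mathsf{T}:[0,\infty)\to\mathscr{L}^r(X)$ such that $t\mapsto\mathsf{T}(t)x$ is continuous for every $x\in X$, $\mathsf{T}(t+s)=\mathsf{T}(t)\mathsf{T}(s)$ for $t,s>0$, and $\mathsf{T}(0)=\mathrm{Id}$. Its generator is $\mathsf{A}x:=\lim_{h\to0^+}\frac1h(\mathsf{T}(h)x-x)$, with $D(\mathsf{A})$ the set of $x\in X$ for which this limit exists in $X$. For a closed right linear operator $\mathsf{A}$ (generators are closed) and $q\in Q_{\mathbb{A}}$: $\Delta_q(\mathsf{A}):=\mathsf{A}^2-2\mathrm{Re}(q)\mathsf{A}+|q|^2\mathrm{Id}:D(\mathsf{A}^2)\to X$. The spherical resolvent set is $\rho_{S}(\mathsf{A}):=\{q\in Q_{\mathbb{A}}:\Delta_q(\mathsf{A})\text{ is bijective and }\Delta_q(\mathsf{A})^{-1}\in\mathscr{L}^r(X)\}$. For $q\in\rho_S(\mathsf{A})$, $\mathsf{Q}_q(\mathsf{A}):=\Delta_q(\mathsf{A})^{-1}$ (spherical quasi-resolvent operator) and $\mathsf{C}_q(\mathsf{A}):=\mathsf{Q}_q(\mathsf{A})q^c-\mathsf{A}\mathsf{Q}_q(\mathsf{A})$ (spherical resolvent operator). *)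

theory Defs
  imports "HOL-Analysis.Analysis" "HOL-Probability.Sinc_Integral"
begin

section \<open>The Clifford algebra $C\ell(0,n)$\<close>

text \<open>
  The index set $\{1,\dots,n\}$ is a finite linearly ordered type \<open>'n\<close> with \<open>CARD('n) = n\<close>; types
  are nonempty, so $n \ge 1$.  An element $\sum_K a_K e_K$ is stored as its coefficient family
  $(a_K)_K$, a vector of Euclidean space $\mathbb{R}^{2^n}$.
\<close>

typedef 'n clifford = "UNIV :: (real ^ ('n::{finite,linorder} set)) set"
  morphisms cl_coord Cl ..

lemma cl_coord_Cl [simp]: "cl_coord (Cl v) = v"
  by (simp add: Cl_inverse)

lemma Cl_cl_coord [simp]: "Cl (cl_coord q) = q"
  by (rule cl_coord_inverse)

lemma clifford_eq_iff: "p = q \<longleftrightarrow> (\<forall>K. cl_coord p $ K = cl_coord q $ K)"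
  by (metis cl_coord_inject vec_eq_iff)

text \<open>
  $e_K e_L = \pm e_{K \mathbin{\triangle} L}$: sorting the word $e_K e_L$ costs one sign for each pair
  $k \in K$, $l \in L$ with $l < k$ (anticommutation), and contracting the repeated letters one
  sign for each pair with $l = k$ (since $e_k^2 = -1$).
\<close>

definition cl_sign :: "'n::linorder set \<Rightarrow> 'n set \<Rightarrow> real" where
  "cl_sign K L = (\<Prod>k\<in>K. \<Prod>l\<in>L. if l \<le> k then -1 else 1)"

instantiation clifford :: ("{finite,linorder}") "{zero,one,plus,minus,uminus,times,scaleR}"
begin

definition "0 = Cl 0"
definition "1 = Cl (axis {} 1)"
definition "p + q = Cl (cl_coord p + cl_coord q)"
definition "p - q = Cl (cl_coord p - cl_coord q)"
definition "- q = Cl (- cl_coord q)"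
definition "r *\<^sub>R q = Cl (r *\<^sub>R cl_coord q)"
definition times_clifford_def:
  "p * q = Cl (\<chi> M. \<Sum>K\<in>UNIV. \<Sum>L\<in>UNIV.
     if sym_diff K L = M then cl_sign K L * cl_coord p $ K * cl_coord q $ L else 0)"

instance ..

end

definition cl_basis :: "'n::{finite,linorder} set \<Rightarrow> 'n clifford" where
  "cl_basis K = Cl (axis K 1)"

lemma cl_coord_simps [simp]:
  "cl_coord 0 = 0" "cl_coord 1 = axis {} 1"
  "cl_coord (p + q) = cl_coord p + cl_coord q"
  "cl_coord (p - q) = cl_coord p - cl_coord q"
  "cl_coord (- q) = - cl_coord q"
  "cl_coord (r *\<^sub>R q) = r *\<^sub>R cl_coord q"
  "cl_coord (cl_basis K) = axis K 1"
  by (simp_all add: zero_clifford_def one_clifford_def plus_clifford_def minus_clifford_def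
      uminus_clifford_def scaleR_clifford_def cl_basis_def)

lemma cl_sign_square: "cl_sign K L * cl_sign K L = 1"
  by (simp add: cl_sign_def flip: prod.distrib) (intro prod.neutral ballI, simp)

lemma cl_sign_sym_diff_left:
  fixes K L M :: "'n::{finite,linorder} set"
  shows "cl_sign (sym_diff K L) M = cl_sign K M * cl_sign L M"
proof -
  define f where "f k = (\<Prod>l\<in>M. if l \<le> k then -1 else (1::real))" for k
  have ff: "f k * f k = 1" for k
    unfolding f_def by (simp flip: prod.distrib) (intro prod.neutral ballI, simp)
  have I: "prod f (K \<inter> L) * prod f (K \<inter> L) = 1"
    by (simp add: ff flip: prod.distrib)
  have K: "prod f K = prod f (K - L) * prod f (K \<inter> L)"
    by (metis finite prod.Int_Diff mult.commute)
  have L: "prod f L = prod f (L - K) * prod f (K \<inter> L)"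
    by (metis finite prod.Int_Diff mult.commute Int_commute)
  have "prod f (sym_diff K L) = prod f (K - L) * prod f (L - K)"
    by (intro prod.union_disjoint) auto
  also have "\<dots> = prod f K * prod f L"
    unfolding K L using I by (simp add: algebra_simps)
  finally show ?thesis by (simp add: cl_sign_def f_def)
qed

lemma cl_sign_sym_diff_right:
  fixes K L M :: "'n::{finite,linorder} set"
  shows "cl_sign K (sym_diff L M) = cl_sign K L * cl_sign K M"
proof -
  define f where "f l = (\<Prod>k\<in>K. if l \<le> k then -1 else (1::real))" for l
  have sw: "cl_sign K N = prod f N" for N
    unfolding cl_sign_def f_def by (rule prod.swap)
  have ff: "f k * f k = 1" for k
    unfolding f_def by (simp flip: prod.distrib) (intro prod.neutral ballI, simp)
  have I: "prod f (L \<inter> M) * prod f (L \<inter> M) = 1"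
    by (simp add: ff flip: prod.distrib)
  have L: "prod f L = prod f (L - M) * prod f (L \<inter> M)"
    by (metis finite prod.Int_Diff mult.commute)
  have M: "prod f M = prod f (M - L) * prod f (L \<inter> M)"
    by (metis finite prod.Int_Diff mult.commute Int_commute)
  have "prod f (sym_diff L M) = prod f (L - M) * prod f (M - L)"
    by (intro prod.union_disjoint) auto
  also have "\<dots> = prod f L * prod f M"
    unfolding L M using I by (simp add: algebra_simps)
  finally show ?thesis by (simp add: sw)
qed

lemma sym_diff_eq_iff: "sym_diff K L = M \<longleftrightarrow> L = sym_diff K M"
  by auto

lemma cl_coord_times:
  "cl_coord (p * q) $ M =
    (\<Sum>K\<in>UNIV. cl_sign K (sym_diff K M) * cl_coord p $ K * cl_coord q $ sym_diff K M)"
  by (simp add: times_clifford_def sym_diff_eq_iff)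

instance clifford :: ("{finite,linorder}") real_algebra_1
proof
  fix p q r :: "'a clifford" and a b :: real
  show "p + q + r = p + (q + r)" "p + q = q + p" "0 + p = p" "- p + p = 0" "p - q = p + - q"
    by (simp_all add: clifford_eq_iff)
  show "a *\<^sub>R (p + q) = a *\<^sub>R p + a *\<^sub>R q" "(a + b) *\<^sub>R p = a *\<^sub>R p + b *\<^sub>R p"
    "a *\<^sub>R b *\<^sub>R p = (a * b) *\<^sub>R p" "1 *\<^sub>R p = p"
    by (simp_all add: clifford_eq_iff algebra_simps)
  show "(p + q) * r = p * r + q * r" "p * (q + r) = p * q + p * r"
    by (simp_all add: clifford_eq_iff cl_coord_times algebra_simps sum.distrib)
  show "a *\<^sub>R p * q = a *\<^sub>R (p * q)" "p * a *\<^sub>R q = a *\<^sub>R (p * q)"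
    by (simp_all add: clifford_eq_iff cl_coord_times algebra_simps sum_distrib_left)
  show "(0::'a clifford) \<noteq> 1"
    by (auto simp: clifford_eq_iff axis_def)
  show "1 * p = p"
    by (simp add: clifford_eq_iff cl_coord_times axis_def cl_sign_def if_distrib
        [where f = "\<lambda>x. _ * x"] if_distrib [where f = "\<lambda>x. x * _"] cong: if_cong)
  show "p * 1 = p"
  proof -
    have "axis {} (1::real) $ sym_diff K M = (if M = K then 1 else 0)" for K M :: "'a set"
      by (auto simp: axis_def)
    then show ?thesis
      by (simp add: clifford_eq_iff cl_coord_times cl_sign_def if_distrib
        [where f = "\<lambda>x. _ * x"] if_distrib [where f = "\<lambda>x. x * _"] cong: if_cong)
  qed
  show "p * q * r = p * (q * r)"
    unfolding clifford_eq_iff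
  proof
    fix N :: "'a set"
    have "cl_coord (p * q * r) $ N =
      (\<Sum>A\<in>UNIV. \<Sum>K\<in>UNIV. cl_sign A (sym_diff A N) * cl_sign K (sym_diff K A) * cl_coord p $ K
         * cl_coord q $ sym_diff K A * cl_coord r $ sym_diff A N)"
      by (simp add: cl_coord_times sum_distrib_left sum_distrib_right mult.assoc)
    also have "\<dots> = (\<Sum>K\<in>UNIV. \<Sum>A\<in>UNIV. cl_sign A (sym_diff A N) * cl_sign K (sym_diff K A)
         * cl_coord p $ K * cl_coord q $ sym_diff K A * cl_coord r $ sym_diff A N)"
      by (rule sum.swap)
    also have "\<dots> = (\<Sum>K\<in>UNIV. \<Sum>B\<in>UNIV. cl_sign (sym_diff K B) (sym_diff B (sym_diff K N))
         * cl_sign K B * cl_coord p $ K * cl_coord q $ B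
         * cl_coord r $ sym_diff B (sym_diff K N))"
    proof (rule sum.cong [OF refl])
      fix K :: "'a set"
      have s1: "sym_diff K (sym_diff K B) = B" for B by auto
      have s2: "sym_diff (sym_diff K B) N = sym_diff B (sym_diff K N)" for B by auto
      have s3: "sym_diff (sym_diff K B) (sym_diff K N) = sym_diff B N" for B by auto
      show "(\<Sum>A\<in>UNIV. cl_sign A (sym_diff A N) * cl_sign K (sym_diff K A)
         * cl_coord p $ K * cl_coord q $ sym_diff K A * cl_coord r $ sym_diff A N)
        = (\<Sum>B\<in>UNIV. cl_sign (sym_diff K B) (sym_diff B (sym_diff K N))
         * cl_sign K B * cl_coord p $ K * cl_coord q $ B
         * cl_coord r $ sym_diff B (sym_diff K N))"
        by (rule sum.reindex_bij_witness [where i = "sym_diff K" and j = "sym_diff K"])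
           (simp_all only: s1 s2 s3 UNIV_I)
    qed
    also have "\<dots> = (\<Sum>K\<in>UNIV. \<Sum>B\<in>UNIV. cl_sign K (sym_diff K N) * cl_coord p $ K *
         (cl_sign B (sym_diff B (sym_diff K N)) * cl_coord q $ B
         * cl_coord r $ sym_diff B (sym_diff K N)))"
    proof (intro sum.cong [OF refl])
      fix K B :: "'a set"
      let ?C = "sym_diff B (sym_diff K N)"
      have "sym_diff K N = sym_diff B ?C" by auto
      then have "cl_sign K (sym_diff K N) = cl_sign K B * cl_sign K ?C"
        by (metis cl_sign_sym_diff_right)
      then show "cl_sign (sym_diff K B) ?C * cl_sign K B * cl_coord p $ K * cl_coord q $ B
         * cl_coord r $ ?C = cl_sign K (sym_diff K N) * cl_coord p $ K *
         (cl_sign B ?C * cl_coord q $ B * cl_coord r $ ?C)"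
        by (simp only: cl_sign_sym_diff_left [of K B] mult_ac)
    qed
    also have "\<dots> = cl_coord (p * (q * r)) $ N"
      by (simp add: cl_coord_times [of p] cl_coord_times [of q] sum_distrib_left)
    finally show "cl_coord (p * q * r) $ N = cl_coord (p * (q * r)) $ N" .
  qed
qed

text \<open>The defining relations hold, and $e_K = e_{k_1} \cdots e_{k_s}$ for $K = \{k_1 < \dots < k_s\}$.\<close>

lemma cl_basis_times: "cl_basis K * cl_basis L = cl_sign K L *\<^sub>R cl_basis (sym_diff K L)"
  unfolding clifford_eq_iff
proof
  fix M
  have *: "axis L (1::real) $ sym_diff K M = axis (sym_diff K L) 1 $ M" for K L M :: "'a set"
    by (auto simp: axis_def)
  have sd: "sym_diff K M = L" if "sym_diff K L = M"
    using that by auto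
  have "cl_coord (cl_basis K * cl_basis L) $ M
      = (\<Sum>A\<in>UNIV. if A = K then cl_sign K (sym_diff K M) * axis (sym_diff K L) 1 $ M else 0)"
    unfolding cl_coord_times cl_coord_simps
    by (intro sum.cong refl) (auto simp only: * axis_def vec_lambda_beta split: if_splits)
  also have "\<dots> = cl_coord (cl_sign K L *\<^sub>R cl_basis (sym_diff K L)) $ M"
    using sd by (auto simp: axis_def)
  finally show "cl_coord (cl_basis K * cl_basis L) $ M
      = cl_coord (cl_sign K L *\<^sub>R cl_basis (sym_diff K L)) $ M" .
qed

lemma cl_basis_empty: "cl_basis {} = 1"
  by (simp add: cl_basis_def one_clifford_def)

lemma cl_basis_square: "cl_basis {k} * cl_basis {k} = - 1"
  by (simp add: cl_basis_times cl_sign_def cl_basis_empty)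

lemma cl_basis_anticommute:
  assumes "k \<noteq> l"
  shows "cl_basis {k} * cl_basis {l} = - (cl_basis {l} * cl_basis {k})"
proof -
  have "sym_diff {k} {l} = sym_diff {l} {k}" by auto
  then show ?thesis
    using assms by (auto simp: cl_basis_times cl_sign_def)
qed

lemma cl_basis_prod_list:
  "sorted xs \<Longrightarrow> distinct xs \<Longrightarrow> cl_basis (set xs) = prod_list (map (\<lambda>k. cl_basis {k}) xs)"
proof (induction xs)
  case Nil
  then show ?case by (simp add: cl_basis_empty)
next
  case (Cons x xs)
  then have "sym_diff {x} (set xs) = set (x # xs)" "cl_sign {x} (set xs) = 1"
    by (force simp: cl_sign_def intro!: prod.neutral)+
  then have "cl_basis {x} * cl_basis (set xs) = cl_basis (set (x # xs))"
    by (simp only: cl_basis_times scaleR_one)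
  with Cons show ?case by simp
qed

lemma cl_sum_basis: "q = (\<Sum>K\<in>UNIV. cl_coord q $ K *\<^sub>R cl_basis K)"
proof -
  have "cl_coord (\<Sum>K\<in>S. f K) = (\<Sum>K\<in>S. cl_coord (f K))"
    for f :: "'a set \<Rightarrow> 'a clifford" and S
    by (induction S rule: infinite_finite_induct) auto
  then show ?thesis
    by (simp add: clifford_eq_iff axis_def if_distrib [where f = "\<lambda>x. _ * x"] cong: if_cong)
qed

subsection \<open>The Clifford operator norm\<close>

definition cl_norm :: "'n::{finite,linorder} clifford \<Rightarrow> real" where
  "cl_norm q = Sup {norm (cl_coord (q * a)) | a. norm (cl_coord a) = 1}"

lemma cl_left_mult_bounded_linear: "bounded_linear (\<lambda>v. cl_coord (q * Cl v))"
proof -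
  have "Cl (u + v) = Cl u + Cl v" "Cl (r *\<^sub>R u) = r *\<^sub>R Cl u" for u v :: "real ^ 'a set" and r
    by (simp_all add: plus_clifford_def scaleR_clifford_def)
  then have "linear (\<lambda>v. cl_coord (q * Cl v))"
    by (intro linearI) (simp_all add: distrib_left)
  then show ?thesis by (simp add: linear_conv_bounded_linear)
qed

lemma cl_norm_bdd: "bdd_above {norm (cl_coord (q * a)) | a. norm (cl_coord a) = 1}"
proof -
  obtain B where "\<And>v. norm (cl_coord (q * Cl v)) \<le> norm v * B"
    using bounded_linear.bounded [OF cl_left_mult_bounded_linear] by blast
  then show ?thesis
    by (intro bdd_aboveI [where M = B]) (auto, metis Cl_cl_coord mult_1)
qed

lemma cl_norm_axis [simp]: "norm (axis K (1::real)) = 1"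
  by (simp add: norm_axis_1)

lemma cl_norm_nonneg: "0 \<le> cl_norm (q :: 'n::{finite,linorder} clifford)"
proof -
  have "norm (cl_coord (q * 1)) \<le> cl_norm q"
    unfolding cl_norm_def using cl_norm_bdd by (intro cSup_upper) (auto intro!: exI [of _ 1])
  then show ?thesis by (metis norm_ge_zero order_trans)
qed

lemma cl_norm_bound: "norm (cl_coord (q * a)) \<le> cl_norm q * norm (cl_coord a)"
proof (cases "norm (cl_coord a) = 0")
  case True
  then have "a = 0" by (simp add: clifford_eq_iff)
  then show ?thesis by simp
next
  case False
  define c where "c = a /\<^sub>R norm (cl_coord a)"
  have "norm (cl_coord c) = 1" using False by (simp add: c_def)
  then have "norm (cl_coord (q * c)) \<le> cl_norm q"
    unfolding cl_norm_def using cl_norm_bdd by (intro cSup_upper) auto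
  moreover have "norm (cl_coord (q * c)) = norm (cl_coord (q * a)) / norm (cl_coord a)"
    using False by (simp add: c_def divide_inverse mult.commute)
  ultimately show ?thesis
    using False by (simp add: pos_divide_le_eq)
qed

lemma cl_norm_least:
  assumes "\<And>a. norm (cl_coord a) = 1 \<Longrightarrow> norm (cl_coord (q * a)) \<le> C"
  shows "cl_norm q \<le> C"
proof -
  have "norm (cl_coord (1 :: 'a clifford)) = 1" by simp
  then show ?thesis
    unfolding cl_norm_def using assms by (intro cSup_least) blast+
qed

lemma cl_coord_norm_le: "norm (cl_coord q) \<le> cl_norm q"
  using cl_norm_bound [of q 1] by simp

lemma cl_norm_scaleR_le: "cl_norm (r *\<^sub>R q) \<le> \<bar>r\<bar> * cl_norm q"
proof (rule cl_norm_least)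
  fix a :: "'a clifford" assume "norm (cl_coord a) = 1"
  then show "norm (cl_coord (r *\<^sub>R q * a)) \<le> \<bar>r\<bar> * cl_norm q"
    using cl_norm_bound [of q a] by (simp add: mult_left_mono)
qed

lemma cl_norm_scaleR: "cl_norm (r *\<^sub>R q) = \<bar>r\<bar> * cl_norm q"
proof (cases "r = 0")
  case True
  then show ?thesis
    using cl_norm_scaleR_le [of r q] cl_norm_nonneg [of "r *\<^sub>R q"] by simp
next
  case False
  then show ?thesis
    using cl_norm_scaleR_le [of r q] cl_norm_scaleR_le [of "inverse r" "r *\<^sub>R q"]
    by (simp add: field_simps)
qed

lemma cl_norm_eq_0: "cl_norm q = 0 \<longleftrightarrow> q = 0"
proof
  assume "cl_norm q = 0"
  then show "q = 0" using cl_coord_norm_le [of q] by (simp add: clifford_eq_iff)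
next
  assume "q = 0"
  then show "cl_norm q = 0" using cl_norm_scaleR [of 0 0] by simp
qed

lemma cl_norm_triangle: "cl_norm (p + q) \<le> cl_norm p + cl_norm q"
proof (rule cl_norm_least)
  fix a :: "'a clifford" assume "norm (cl_coord a) = 1"
  then show "norm (cl_coord ((p + q) * a)) \<le> cl_norm p + cl_norm q"
    using cl_norm_bound [of p a] cl_norm_bound [of q a]
      norm_triangle_ineq [of "cl_coord (p * a)" "cl_coord (q * a)"]
    by (simp add: distrib_right)
qed

lemma cl_norm_mult: "cl_norm (p * q) \<le> cl_norm p * cl_norm q"
proof (rule cl_norm_least)
  fix a :: "'a clifford" assume a: "norm (cl_coord a) = 1"
  have "norm (cl_coord (p * (q * a))) \<le> cl_norm p * norm (cl_coord (q * a))"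
    by (rule cl_norm_bound)
  also have "\<dots> \<le> cl_norm p * cl_norm q"
    using cl_norm_bound [of q a] a cl_norm_nonneg [of p] by (simp add: mult_left_mono)
  finally show "norm (cl_coord (p * q * a)) \<le> cl_norm p * cl_norm q"
    by (simp add: mult.assoc)
qed

lemma cl_norm_one: "cl_norm 1 = 1"
proof (rule antisym)
  show "cl_norm (1 :: 'a clifford) \<le> 1" by (rule cl_norm_least) simp
  show "1 \<le> cl_norm (1 :: 'a clifford)" using cl_coord_norm_le [of "1 :: 'a clifford"] by simp
qed

instantiation clifford :: ("{finite,linorder}") real_normed_algebra_1
begin

definition norm_clifford_def: "norm (q :: 'a clifford) = cl_norm q"
definition "sgn (q :: 'a clifford) = q /\<^sub>R norm q"
definition "dist (p :: 'a clifford) q = norm (p - q)"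
definition [code del]: "(uniformity :: ('a clifford \<times> 'a clifford) filter) =
  (INF e\<in>{0 <..}. principal {(p, q). dist p q < e})"
definition [code del]: "open (U :: 'a clifford set) \<longleftrightarrow>
  (\<forall>p\<in>U. eventually (\<lambda>(p', q). p' = p \<longrightarrow> q \<in> U) uniformity)"

instance
  by standard (simp_all add: norm_clifford_def sgn_clifford_def dist_clifford_def
      uniformity_clifford_def open_clifford_def cl_norm_eq_0 cl_norm_triangle cl_norm_scaleR
      cl_norm_mult cl_norm_one)

end

instance clifford :: ("{finite,linorder}") banach
proof
  fix X :: "nat \<Rightarrow> 'a clifford"
  assume X: "Cauchy X"
  have "Cauchy (\<lambda>i. cl_coord (X i))"
  proof (rule metric_CauchyI)
    fix e :: real assume "0 < e"
    then obtain N where "\<forall>i\<ge>N. \<forall>j\<ge>N. dist (X i) (X j) < e"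
      using metric_CauchyD [OF X] by blast
    moreover have "dist (cl_coord (X i)) (cl_coord (X j)) \<le> dist (X i) (X j)" for i j
      using cl_coord_norm_le [of "X i - X j"] by (simp add: dist_norm norm_clifford_def)
    ultimately show "\<exists>N. \<forall>i\<ge>N. \<forall>j\<ge>N. dist (cl_coord (X i)) (cl_coord (X j)) < e"
      by (meson le_less_trans)
  qed
  then obtain v where v: "(\<lambda>i. cl_coord (X i)) \<longlonglongrightarrow> v"
    using Cauchy_convergent_iff convergentD by blast
  have "linear (Cl :: real ^ 'a set \<Rightarrow> 'a clifford)"
    by (intro linearI) (simp_all add: plus_clifford_def scaleR_clifford_def)
  then have "bounded_linear (Cl :: real ^ 'a set \<Rightarrow> 'a clifford)"
    by (simp add: linear_conv_bounded_linear)
  from bounded_linear.tendsto [OF this v] show "convergent X"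
    by (auto simp: convergent_def)
qed

subsection \<open>Conjugation and the quadratic cone\<close>

definition cl_conj :: "'n::{finite,linorder} clifford \<Rightarrow> 'n clifford" where
  "cl_conj q = (\<Sum>K\<in>UNIV. ((-1) ^ (card K * (card K + 1) div 2) * cl_coord q $ K) *\<^sub>R cl_basis K)"

definition cl_Re :: "'n::{finite,linorder} clifford \<Rightarrow> 'n clifford" where
  "cl_Re q = (q + cl_conj q) /\<^sub>R 2"

definition cl_Im :: "'n::{finite,linorder} clifford \<Rightarrow> 'n clifford" where
  "cl_Im q = (q - cl_conj q) /\<^sub>R 2"

definition cl_imag_units :: "'n::{finite,linorder} clifford set" where
  "cl_imag_units = {q. cl_conj q = - q \<and> q\<^sup>2 = - 1}"

definition cl_plane :: "'n::{finite,linorder} clifford \<Rightarrow> 'n clifford set" where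
  "cl_plane j = {of_real r + of_real s * j | r s. True}"

definition cl_cone :: "'n::{finite,linorder} clifford set" where
  "cl_cone = (\<Union>j\<in>cl_imag_units. cl_plane j)"

text \<open>
  \<open>cl_Re q\<close> read as a real number.  On the quadratic cone no information is lost: see
  \<open>cl_Re_eq_of_real\<close>.
\<close>

definition cl_re :: "'n::{finite,linorder} clifford \<Rightarrow> real" where
  "cl_re q = cl_coord (cl_Re q) $ {}"

lemma cl_coord_conj:
  "cl_coord (cl_conj q) $ K = (-1) ^ (card K * (card K + 1) div 2) * cl_coord q $ K"
proof -
  have "cl_coord (\<Sum>K\<in>S. f K) = (\<Sum>K\<in>S. cl_coord (f K))"
    for f :: "'a set \<Rightarrow> 'a clifford" and S
    by (induction S rule: infinite_finite_induct) auto
  then show ?thesis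
    by (simp add: cl_conj_def axis_def if_distrib [where f = "\<lambda>x. _ * x"] cong: if_cong)
qed

lemma cl_Re_eq_of_real:
  assumes "q \<in> cl_cone"
  shows "cl_Re q = of_real (cl_re q)"
proof -
  obtain j r s where j: "cl_conj j = - j" and q: "q = of_real r + of_real s * j"
    using assms by (auto simp: cl_cone_def cl_plane_def cl_imag_units_def)
  have add: "cl_conj (u + v) = cl_conj u + cl_conj v" for u v :: "'a clifford"
    by (simp add: clifford_eq_iff cl_coord_conj algebra_simps)
  have scale: "cl_conj (c *\<^sub>R u) = c *\<^sub>R cl_conj u" for c and u :: "'a clifford"
    by (simp add: clifford_eq_iff cl_coord_conj)
  have one: "cl_conj (1 :: 'a clifford) = 1"
    by (simp add: clifford_eq_iff cl_coord_conj axis_def)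
  have "cl_conj q = of_real r - s *\<^sub>R j"
    unfolding q using j by (simp add: add scale one of_real_def)
  then have "cl_Re q = of_real r"
    by (simp add: cl_Re_def q of_real_def flip: scaleR_add_left)
  then show ?thesis
    by (simp add: cl_re_def of_real_def)
qed

section \<open>Banach two-sided modules\<close>

text \<open>
  A Banach two-sided module is a Banach space in the sense of the class \<open>banach\<close> with two scalar
  multiplications, where the real scalar multiplication of the class is multiplication by
  $\mathbb{R}1$.  The homogeneity \<open>norm (r *\<^sub>R x) = \<bar>r\<bar> * norm x\<close> built into the class is
  no extra assumption: it follows from \<open>norm_lscale_le\<close> applied to $r$ and $r^{-1}$.
\<close>

locale banach_bimodule =
  fixes lscale :: "'n::{finite,linorder} clifford \<Rightarrow> 'x::banach \<Rightarrow> 'x"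
    and rscale :: "'x \<Rightarrow> 'n clifford \<Rightarrow> 'x"
  assumes lscale_add_right: "lscale q (x + y) = lscale q x + lscale q y"
    and lscale_add_left: "lscale (p + q) x = lscale p x + lscale q x"
    and rscale_add_left: "rscale (x + y) q = rscale x q + rscale y q"
    and rscale_add_right: "rscale x (p + q) = rscale x p + rscale x q"
    and lscale_one: "lscale 1 x = x"
    and rscale_one: "rscale x 1 = x"
    and lscale_lscale: "lscale p (lscale q x) = lscale (p * q) x"
    and rscale_rscale: "rscale (rscale x p) q = rscale x (p * q)"
    and lscale_rscale: "lscale p (rscale x q) = rscale (lscale p x) q"
    and lscale_of_real: "lscale (of_real r) x = rscale x (of_real r)"
    and lscale_scaleR: "lscale (of_real r) x = r *\<^sub>R x"
    and norm_lscale_le: "norm (lscale q x) \<le> norm q * norm x"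
    and norm_rscale_le: "norm (rscale x q) \<le> norm q * norm x"

section \<open>Right linear operators and semigroups\<close>

definition right_linear :: "('x::banach \<Rightarrow> 'n::{finite,linorder} clifford \<Rightarrow> 'x) \<Rightarrow> ('x \<Rightarrow> 'x) \<Rightarrow> bool"
  where "right_linear rscale B \<longleftrightarrow>
    (\<forall>x y. B (x + y) = B x + B y) \<and> (\<forall>x q. B (rscale x q) = rscale (B x) q)"

text \<open>
  The operator norm of elements of \<open>bounded_right_linear\<close> is the library's \<open>onorm\<close>; at $x = 0$ it
  takes the harmless quotient \<open>0 / 0 = 0\<close> into the supremum, which gives the right value $0$ also if
  $X = \{0\}$.
\<close>

definition bounded_right_linear ::
    "('x::banach \<Rightarrow> 'n::{finite,linorder} clifford \<Rightarrow> 'x) \<Rightarrow> ('x \<Rightarrow> 'x) set"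
  where "bounded_right_linear rscale =
    {B. right_linear rscale B \<and> bdd_above {norm (B x) / norm x | x. x \<noteq> 0}}"

definition op_scale :: "('n::{finite,linorder} clifford \<Rightarrow> 'x::banach \<Rightarrow> 'x) \<Rightarrow>
    ('x \<Rightarrow> 'x) \<Rightarrow> 'n clifford \<Rightarrow> 'x \<Rightarrow> 'x"
  where "op_scale lscale B p = (\<lambda>x. B (lscale p x))"

definition sc_semigroup ::
    "('x::banach \<Rightarrow> 'n::{finite,linorder} clifford \<Rightarrow> 'x) \<Rightarrow> (real \<Rightarrow> 'x \<Rightarrow> 'x) \<Rightarrow> bool"
  where "sc_semigroup rscale T \<longleftrightarrow>
    (\<forall>t\<ge>0. T t \<in> bounded_right_linear rscale) \<and>
    (\<forall>x. continuous_on {0..} (\<lambda>t. T t x)) \<and>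
    (\<forall>t>0. \<forall>s>0. T (t + s) = T t \<circ> T s) \<and>
    T 0 = id"

text \<open>An operator with domain $D \subseteq X$ is a pair of \<open>D\<close> and a function whose values outside
  \<open>D\<close> are irrelevant.\<close>

definition generator_domain :: "(real \<Rightarrow> 'x::banach \<Rightarrow> 'x) \<Rightarrow> 'x set" where
  "generator_domain T = {x. \<exists>y. ((\<lambda>h. (T h x - x) /\<^sub>R h) \<longlongrightarrow> y) (at_right 0)}"

definition generator :: "(real \<Rightarrow> 'x::banach \<Rightarrow> 'x) \<Rightarrow> 'x \<Rightarrow> 'x" where
  "generator T x = Lim (at_right 0) (\<lambda>h. (T h x - x) /\<^sub>R h)"

section \<open>Spherical resolvents\<close>

definition square_domain :: "'x set \<Rightarrow> ('x \<Rightarrow> 'x) \<Rightarrow> 'x set" where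
  "square_domain D A = {x \<in> D. A x \<in> D}"

definition sph_Delta :: "('x::banach \<Rightarrow> 'x) \<Rightarrow> 'n::{finite,linorder} clifford \<Rightarrow> 'x \<Rightarrow> 'x" where
  "sph_Delta A q x = A (A x) - (2 * cl_re q) *\<^sub>R A x + (norm q)\<^sup>2 *\<^sub>R x"

definition quasi_resolvent :: "'x set \<Rightarrow> ('x::banach \<Rightarrow> 'x) \<Rightarrow>
    'n::{finite,linorder} clifford \<Rightarrow> 'x \<Rightarrow> 'x"
  where "quasi_resolvent D A q = inv_into (square_domain D A) (sph_Delta A q)"

definition sph_resolvent_set :: "('x \<Rightarrow> 'n::{finite,linorder} clifford \<Rightarrow> 'x) \<Rightarrow>
    'x set \<Rightarrow> ('x::banach \<Rightarrow> 'x) \<Rightarrow> 'n clifford set"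
  where "sph_resolvent_set rscale D A = {q \<in> cl_cone.
    bij_betw (sph_Delta A q) (square_domain D A) UNIV \<and>
    quasi_resolvent D A q \<in> bounded_right_linear rscale}"

definition sph_resolvent :: "('n::{finite,linorder} clifford \<Rightarrow> 'x \<Rightarrow> 'x) \<Rightarrow>
    'x set \<Rightarrow> ('x::banach \<Rightarrow> 'x) \<Rightarrow> 'n clifford \<Rightarrow> 'x \<Rightarrow> 'x"
  where "sph_resolvent lscale D A q =
    (\<lambda>x. op_scale lscale (quasi_resolvent D A q) (cl_conj q) x - A (quasi_resolvent D A q x))"

section \<open>The Bochner integral in an arbitrary Banach space\<close>

text \<open>
  The library's \<open>has_bochner_integral\<close> is confined to second countable (separable) target spaces.
  Here is its definition, word for word, without that restriction.  Borel measurability of \<open>f\<close> together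
  with $L^1$-approximation by integrable simple functions amounts to strong measurability and
  integrability of the norm.
\<close>

definition has_bochner :: "'a measure \<Rightarrow> ('a \<Rightarrow> 'b::real_normed_vector) \<Rightarrow> 'b \<Rightarrow> bool" where
  "has_bochner M f x \<longleftrightarrow> f \<in> borel_measurable M \<and>
    (\<exists>s. (\<forall>i. Bochner_Integration.simple_bochner_integrable M (s i)) \<and>
      (\<lambda>i. \<integral>\<^sup>+ t. norm (f t - s i t) \<partial>M) \<longlonglongrightarrow> 0 \<and>
      (\<lambda>i. Bochner_Integration.simple_bochner_integral M (s i)) \<longlonglongrightarrow> x)"

lemma has_bochner_unique:
  assumes "has_bochner M f x" "has_bochner M f y"
  shows "x = y"
proof -
  let ?S = "Bochner_Integration.simple_bochner_integral M"
  let ?I = "Bochner_Integration.simple_bochner_integrable M"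
  obtain s t where f: "f \<in> borel_measurable M" and s: "\<And>i. ?I (s i)" and t: "\<And>i. ?I (t i)"
    and s0: "(\<lambda>i. \<integral>\<^sup>+ u. norm (f u - s i u) \<partial>M) \<longlonglongrightarrow> 0"
    and t0: "(\<lambda>i. \<integral>\<^sup>+ u. norm (f u - t i u) \<partial>M) \<longlonglongrightarrow> 0"
    and sx: "(\<lambda>i. ?S (s i)) \<longlonglongrightarrow> x" and ty: "(\<lambda>i. ?S (t i)) \<longlonglongrightarrow> y"
    using assms unfolding has_bochner_def by blast
  have meas: "(\<lambda>u. norm (f u - g u)) \<in> borel_measurable M" if "?I g" for g
  proof -
    have g: "simple_function M g" using that by cases
    have "(\<lambda>u. norm (f u - v)) \<in> borel_measurable M" for v
      using f by (rule measurable_compose) (intro borel_measurable_continuous_onI continuous_intros)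
    moreover have "g -` {v} \<inter> space M \<in> sets M" for v
      using g by (rule simple_functionD)
    ultimately have "(\<lambda>u. \<Sum>v\<in>g ` space M. indicator (g -` {v} \<inter> space M) u * norm (f u - v))
        \<in> borel_measurable M"
      by (intro borel_measurable_sum borel_measurable_times borel_measurable_indicator)
    moreover have "(\<Sum>v\<in>g ` space M. indicator (g -` {v} \<inter> space M) u * norm (f u - v))
        = norm (f u - g u)" if "u \<in> space M" for u
    proof -
      have "(\<Sum>v\<in>g ` space M. indicator (g -` {v} \<inter> space M) u * norm (f u - v))
          = (\<Sum>v\<in>g ` space M. if v = g u then norm (f u - v) else 0)"
        using that by (intro sum.cong) (auto simp: indicator_def)
      then show ?thesis
        using that simple_functionD(1) [OF g] by simp
    qed
    ultimately show ?thesis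
      by (subst measurable_cong) (auto intro: sym)
  qed
  have bound: "ennreal (norm (?S (s i) - ?S (t i)))
      \<le> (\<integral>\<^sup>+ u. norm (f u - s i u) \<partial>M) + (\<integral>\<^sup>+ u. norm (f u - t i u) \<partial>M)" for i
  proof -
    have d: "?I (\<lambda>u. s i u - t i u)" "?I (\<lambda>u. norm (s i u - t i u))"
      using simple_bochner_integrable_compose2 [of "(-)", OF _ s t]
        simple_bochner_integrable_compose2 [of "\<lambda>x y. norm (x - y)", OF _ s t] by auto
    have "norm (?S (s i) - ?S (t i)) = norm (?S (\<lambda>u. s i u - t i u))"
      by (simp add: simple_bochner_integral_diff [OF s t])
    also have "\<dots> \<le> Bochner_Integration.simple_bochner_integral M (\<lambda>u. norm (s i u - t i u))"
      by (rule simple_bochner_integral_norm_bound [OF d(1)])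
    finally have "ennreal (norm (?S (s i) - ?S (t i))) \<le>
        ennreal (Bochner_Integration.simple_bochner_integral M (\<lambda>u. norm (s i u - t i u)))"
      by (rule ennreal_leI)
    also have "\<dots> = (\<integral>\<^sup>+ u. norm (s i u - t i u) \<partial>M)"
      by (rule simple_bochner_integral_eq_nn_integral [OF d(2)]) simp
    also have "\<dots> \<le> (\<integral>\<^sup>+ u. ennreal (norm (f u - s i u)) + ennreal (norm (f u - t i u)) \<partial>M)"
    proof (rule nn_integral_mono)
      fix u
      have "norm (s i u - t i u) \<le> norm (f u - s i u) + norm (f u - t i u)"
        using norm_triangle_ineq4 [of "f u - t i u" "f u - s i u"] by (simp add: add.commute)
      then show "ennreal (norm (s i u - t i u))
          \<le> ennreal (norm (f u - s i u)) + ennreal (norm (f u - t i u))"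
        by (simp flip: ennreal_plus)
    qed
    also have "\<dots> = (\<integral>\<^sup>+ u. norm (f u - s i u) \<partial>M) + (\<integral>\<^sup>+ u. norm (f u - t i u) \<partial>M)"
      using meas [OF s] meas [OF t] by (intro nn_integral_add) auto
    finally show ?thesis .
  qed
  have "(\<lambda>i. ennreal (norm (?S (s i) - ?S (t i)))) \<longlonglongrightarrow> ennreal 0"
  proof (rule tendsto_sandwich)
    show "(\<lambda>_. 0) \<longlonglongrightarrow> ennreal 0" by simp
    show "(\<lambda>i. (\<integral>\<^sup>+ u. norm (f u - s i u) \<partial>M) + (\<integral>\<^sup>+ u. norm (f u - t i u) \<partial>M)) \<longlonglongrightarrow> ennreal 0"
      using tendsto_add [OF s0 t0] by simp
  qed (use bound in auto)
  then have "(\<lambda>i. norm (?S (s i) - ?S (t i))) \<longlonglongrightarrow> 0"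
    by (simp flip: ennreal_0)
  moreover have "(\<lambda>i. norm (?S (s i) - ?S (t i))) \<longlonglongrightarrow> norm (x - y)"
    using sx ty by (intro tendsto_intros)
  ultimately have "norm (x - y) = 0"
    using LIMSEQ_unique by blast
  then show ?thesis by simp
qed

lemma has_bochner_iff_has_bochner_integral:
  fixes f :: "'a \<Rightarrow> 'b::{real_normed_vector, second_countable_topology}"
  shows "has_bochner M f x \<longleftrightarrow> has_bochner_integral M f x"
  by (auto simp: has_bochner_def has_bochner_integral.simps)

end

theory Submission
  imports Defs "HOL-Real_Asymp.Real_Asymp"
begin

text \<open>
  Write $J_\varphi x = \int_0^\infty \varphi(t)\,\mathsf{T}(t)x\,dt$ for a scalar weight $\varphi$ decaying
  faster than $e^{-\omega t}$.  Let $q = a + s\mathbf{j}$, $b = |s|$, and take the two weights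
  $S(t) = e^{-at}\, t\, \mathrm{sinc}(bt)$ and $C(t) = e^{-at}\cos(bt)$.  Together they are closed under
  translation: by the addition theorems, $S(t-h)$ and $C(t-h)$ are combinations of $S(t)$ and $C(t)$
  with coefficients depending on $h$ only.  As $\mathsf{T}(h)J_\varphi x = \int_h^\infty
  \varphi(t-h)\,\mathsf{T}(t)x\,dt$, this gives a closed formula for $\mathsf{T}(h)J_S x$ and
  $\mathsf{T}(h)J_C x$ (\<open>T_orbit_integral\<close>), and differentiating it at $h = 0$ yields
  $$\mathsf{A}J_S x = a J_S x - J_C x, \qquad \mathsf{A}J_C x = a J_C x + b^2 J_S x - x$$
  (\<open>generator_damped_sin\<close>, \<open>generator_damped_cos\<close>).

  Since $|q|^2 = a^2 + b^2$, the two formulas combine to $\Delta_q(\mathsf{A}) J_S x = x$.  The bounded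
  operator $J_S$ commutes with the semigroup, hence with $\mathsf{A}$ on the domain of $\mathsf{A}$, so
  that also $J_S \Delta_q(\mathsf{A})x = x$ on the domain of $\mathsf{A}^2$.  Thus
  $\mathsf{Q}_q(\mathsf{A}) = J_S$, and $g_q = S$, $g_q' = C - aS$ give the first two integral formulas.

  For the third, $\mathsf{C}_q(\mathsf{A})x = J_S(q^c x) - aJ_S x + J_C x = J_C x - s J_S(\mathbf{j}x)$, while
  Euler's formula $e^{-tq} = e^{-at}(\cos(st) - \sin(st)\,\mathbf{j})$ and $s\, t\,\mathrm{sinc}(bt) =
  \sin(st)$ give $e^{-tq} = C(t) - s S(t)\,\mathbf{j}$.  The norm bounds follow by integrating
  $|S(t)| \le t e^{-at}$ and $|e^{-tq}| = e^{-at}$.  The last equality, like $|q|^2 = a^2 + b^2$, holds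
  for the Clifford operator norm because left multiplication by $q^c$ is the Euclidean adjoint of left
  multiplication by $q$ (\<open>cl_left_mult_adjoint\<close>), so that an element with $q^c q = r^2$
  multiplies Euclidean lengths by $r$.

  The integrals are handled as limits of integrals over compact intervals; for continuous,
  exponentially decaying functions these limits are Bochner integrals
  (\<open>has_improper_integral_imp_has_bochner\<close>).
\<close>

section \<open>Improper integrals of exponentially decaying functions\<close>

text \<open>
  Limits over compact intervals inherit linearity, translation and norm bounds directly from
  the integral over \<open>{0..N}\<close>, in every Banach space.
\<close>

definition has_improper_integral :: "(real \<Rightarrow> 'b::real_normed_vector) \<Rightarrow> 'b \<Rightarrow> bool" where
  "has_improper_integral f I \<longleftrightarrow> ((\<lambda>N. integral {0..N} f) \<longlongrightarrow> I) at_top"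

definition exp_decaying :: "(real \<Rightarrow> 'b::real_normed_vector) \<Rightarrow> bool" where
  "exp_decaying f \<longleftrightarrow>
    continuous_on {0..} f \<and> (\<exists>K c. c > 0 \<and> (\<forall>t\<ge>0. norm (f t) \<le> K * exp (- c * t)))"

lemma integrable_on_half_line:
  fixes f :: "real \<Rightarrow> 'b::banach"
  assumes "continuous_on {0..} f" "0 \<le> u"
  shows "f integrable_on {u..v}"
  using assms by (intro integrable_continuous_real) (auto intro: continuous_on_subset)

lemma has_improper_integral_unique:
  "has_improper_integral f I \<Longrightarrow> has_improper_integral f J \<Longrightarrow> I = J"
  unfolding has_improper_integral_def by (rule tendsto_unique[OF trivial_limit_at_top_linorder])

lemma has_improper_integral_cong:
  assumes "\<And>t. t \<ge> 0 \<Longrightarrow> f t = g t"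
  shows "has_improper_integral f I \<longleftrightarrow> has_improper_integral g I"
proof -
  have "integral {0..N} f = integral {0..N} g" for N
    using assms by (intro integral_cong) auto
  then show ?thesis by (simp add: has_improper_integral_def)
qed

lemma has_improper_integral_linear:
  fixes f :: "real \<Rightarrow> 'b::banach" and G :: "'b \<Rightarrow> 'c::banach"
  assumes "continuous_on {0..} f" "has_improper_integral f I" "bounded_linear G"
  shows "has_improper_integral (\<lambda>t. G (f t)) (G I)"
proof -
  have "integral {0..N} (\<lambda>t. G (f t)) = G (integral {0..N} f)" for N
    using integral_linear[OF integrable_on_half_line[OF assms(1) order_refl] assms(3)]
    by (simp add: o_def)
  then show ?thesis
    using bounded_linear.tendsto[OF assms(3)] assms(2) by (simp add: has_improper_integral_def)
qed

lemma has_improper_integral_add: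
  fixes f g :: "real \<Rightarrow> 'b::banach"
  assumes "continuous_on {0..} f" "has_improper_integral f I"
    and "continuous_on {0..} g" "has_improper_integral g J"
  shows "has_improper_integral (\<lambda>t. f t + g t) (I + J)"
proof -
  have "integral {0..N} (\<lambda>t. f t + g t) = integral {0..N} f + integral {0..N} g" for N
    using assms by (intro integral_add integrable_on_half_line) auto
  then show ?thesis
    using assms(2,4) by (simp add: has_improper_integral_def tendsto_add)
qed

lemma has_improper_integral_shift:
  fixes f :: "real \<Rightarrow> 'b::banach"
  assumes f: "continuous_on {0..} f" "has_improper_integral f I" and h: "h \<ge> 0"
  shows "has_improper_integral (\<lambda>t. f (t + h)) (I - integral {0..h} f)"
proof -
  have "eventually (\<lambda>N. integral {0..N} (\<lambda>t. f (t + h))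
      = integral {0..N + h} f - integral {0..h} f) at_top"
    using eventually_ge_at_top[of 0]
  proof eventually_elim
    case (elim N)
    have "integral {0..h} f + integral {h..N + h} f = integral {0..N + h} f"
      by (rule Henstock_Kurzweil_Integration.integral_combine) (use elim h integrable_on_half_line[OF f(1)] in auto)
    moreover have "integral {0..N} (\<lambda>t. f (t + h)) = integral {h..N + h} f"
      using integral_shift_real_ivl[of h h "N + h" f] by simp
    ultimately show ?case by (simp add: algebra_simps)
  qed
  moreover have "((\<lambda>N. integral {0..N + h} f) \<longlongrightarrow> I) at_top"
    using f(2) unfolding has_improper_integral_def
    by (rule filterlim_compose) real_asymp
  then have "((\<lambda>N. integral {0..N + h} f - integral {0..h} f) \<longlongrightarrow> I - integral {0..h} f) at_top"
    by (intro tendsto_intros)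
  ultimately show ?thesis
    unfolding has_improper_integral_def by (simp add: tendsto_cong)
qed

text \<open>
  The majorant is given through an antiderivative \<open>H\<close>, so that explicit constants come out
  without evaluating an integral.
\<close>

lemma has_improper_integral_norm_le:
  fixes f :: "real \<Rightarrow> 'b::banach"
  assumes f: "continuous_on {0..} f" "has_improper_integral f I"
    and h: "\<And>t. t \<ge> 0 \<Longrightarrow> norm (f t) \<le> h t"
    and H: "\<And>t. t \<ge> 0 \<Longrightarrow> (H has_real_derivative h t) (at t)"
    and B: "\<And>t. t \<ge> 0 \<Longrightarrow> H t - H 0 \<le> B"
  shows "norm I \<le> B"
proof -
  have "norm (integral {0..N} f) \<le> B" if N: "N \<ge> 0" for N
  proof -
    have hN: "(h has_integral (H N - H 0)) {0..N}"
      using N H by (intro fundamental_theorem_of_calculus)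
        (auto simp: has_real_derivative_iff_has_vector_derivative
          intro: has_vector_derivative_at_within)
    have "norm (integral {0..N} f) \<le> integral {0..N} h"
      using h integrable_on_half_line[OF f(1)] has_integral_integrable[OF hN]
      by (intro integral_norm_bound_integral) auto
    also have "\<dots> = H N - H 0" using hN by (rule integral_unique)
    finally show ?thesis using B[OF N] by simp
  qed
  then have "eventually (\<lambda>N. norm (integral {0..N} f) \<le> B) at_top"
    using eventually_ge_at_top[of 0] by (rule eventually_mono[rotated])
  moreover have "((\<lambda>N. norm (integral {0..N} f)) \<longlongrightarrow> norm I) at_top"
    using f(2) unfolding has_improper_integral_def by (rule tendsto_norm)
  ultimately show ?thesis
    by (intro tendsto_upperbound[OF _ _ trivial_limit_at_top_linorder])
qed

text \<open>
  The integral of the majorant over \<open>{u..v}\<close> is at most $(K/c)e^{-cu}$.  This makes the integrals over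
  \<open>{0..n}\<close> a Cauchy sequence, and the same tail bound extends convergence from integer to real
  upper limits.
\<close>

lemma exp_decaying_has_improper_integral:
  fixes f :: "real \<Rightarrow> 'b::banach"
  assumes "exp_decaying f"
  shows "\<exists>I. has_improper_integral f I"
proof -
  obtain K c where f: "continuous_on {0..} f" and c: "c > 0"
    and K: "\<And>t. t \<ge> 0 \<Longrightarrow> norm (f t) \<le> K * exp (- c * t)"
    using assms unfolding exp_decaying_def by blast
  have K0: "0 \<le> K" using order_trans[OF norm_ge_zero K[of 0]] by simp
  define F where "F N = integral {0..N} f" for N
  have tail: "norm (F v - F u) \<le> K / c * exp (- c * u)" if "0 \<le> u" "u \<le> v" for u v
  proof -
    have h: "((\<lambda>t. K * exp (- c * t))
        has_integral (- K / c * exp (- c * v) - (- K / c * exp (- c * u)))) {u..v}"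
      using that c by (intro fundamental_theorem_of_calculus)
        (auto simp: has_real_derivative_iff_has_vector_derivative[symmetric]
          intro!: derivative_eq_intros)
    have "F u + integral {u..v} f = F v"
      unfolding F_def using that f by (intro Henstock_Kurzweil_Integration.integral_combine integrable_on_half_line) auto
    then have "F v - F u = integral {u..v} f" by (simp add: algebra_simps)
    also have "norm \<dots> \<le> integral {u..v} (\<lambda>t. K * exp (- c * t))"
      using K that(1) integrable_on_half_line[OF f that(1)] has_integral_integrable[OF h]
      by (intro integral_norm_bound_integral) auto
    also have "\<dots> = K / c * exp (- c * u) - K / c * exp (- c * v)"
      using integral_unique[OF h] by simp
    also have "\<dots> \<le> K / c * exp (- c * u)" using K0 c by simp
    finally show ?thesis .
  qed
  have lim: "((\<lambda>u. K / c * exp (- c * u)) \<longlongrightarrow> 0) at_top"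
  proof -
    have "filterlim (\<lambda>u. - c * u) at_bot at_top"
      using c by (intro filterlim_tendsto_neg_mult_at_bot[OF tendsto_const _ filterlim_ident]) auto
    then have "((\<lambda>u. exp (- c * u)) \<longlongrightarrow> 0) at_top"
      by (rule filterlim_compose[OF exp_at_bot])
    then show ?thesis using tendsto_mult_right_zero by blast
  qed
  have "Cauchy (\<lambda>n. F (real n))"
  proof (rule CauchyI')
    fix e :: real assume "0 < e"
    then have "eventually (\<lambda>u. K / c * exp (- c * u) < e) at_top"
      using lim by (intro order_tendstoD(2))
    then obtain u0 where u0: "\<And>u. u \<ge> u0 \<Longrightarrow> K / c * exp (- c * u) < e"
      by (auto simp: eventually_at_top_linorder)
    show "\<exists>m0. \<forall>m\<ge>m0. \<forall>n>m. dist (F (real m)) (F (real n)) < e"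
    proof (intro exI[of _ "nat \<lceil>u0\<rceil>"] allI impI)
      fix m n :: nat assume "m \<ge> nat \<lceil>u0\<rceil>" "n > m"
      then show "dist (F (real m)) (F (real n)) < e"
        using tail[of "real m" "real n"] u0[of "real m"] by (simp add: dist_norm norm_minus_commute)
    qed
  qed
  then obtain I where I: "(\<lambda>n. F (real n)) \<longlonglongrightarrow> I"
    using Cauchy_convergent_iff convergentD by blast
  have "norm (F u - I) \<le> K / c * exp (- c * u)" if u: "u \<ge> 0" for u
  proof (rule tendsto_upperbound)
    show "(\<lambda>n. norm (F u - F (real n))) \<longlonglongrightarrow> norm (F u - I)"
      using I by (intro tendsto_intros)
    show "\<forall>\<^sub>F n in sequentially. norm (F u - F (real n)) \<le> K / c * exp (- c * u)"
      using eventually_ge_at_top[of "nat \<lceil>u\<rceil>"]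
    proof eventually_elim
      case (elim n)
      then show ?case
        using tail[OF u, of "real n"] by (simp add: norm_minus_commute[of "F u"])
    qed
  qed simp
  then have "((\<lambda>u. F u - I) \<longlongrightarrow> 0) at_top"
    by (intro Lim_null_comparison[OF eventually_mono[OF eventually_ge_at_top[of 0]] lim])
  then have "(F \<longlongrightarrow> I) at_top" by (simp add: LIM_zero_iff)
  then show ?thesis unfolding has_improper_integral_def F_def by blast
qed

lemma exp_decaying_cong:
  assumes "\<And>t. t \<ge> 0 \<Longrightarrow> f t = g t"
  shows "exp_decaying f \<longleftrightarrow> exp_decaying g"
proof -
  have "continuous_on {0..} f \<longleftrightarrow> continuous_on {0..} g"
    using assms by (intro continuous_on_cong) auto
  then show ?thesis using assms by (simp add: exp_decaying_def)
qed

lemma exp_decaying_scaleR: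
  assumes "exp_decaying f"
  shows "exp_decaying (\<lambda>t. r *\<^sub>R f t)"
proof -
  obtain K c where f: "continuous_on {0..} f" and c: "c > 0"
    and K: "\<And>t. t \<ge> 0 \<Longrightarrow> norm (f t) \<le> K * exp (- c * t)"
    using assms unfolding exp_decaying_def by blast
  have "norm (r *\<^sub>R f t) \<le> (\<bar>r\<bar> * K) * exp (- c * t)" if "t \<ge> 0" for t
    using mult_left_mono[OF K[OF that], of "\<bar>r\<bar>"] by (simp add: mult.assoc)
  then show ?thesis
    using f c unfolding exp_decaying_def
    by (intro conjI exI[of _ "\<bar>r\<bar> * K"] exI[of _ c]) (auto intro!: continuous_intros)
qed

lemma exp_decaying_add:
  assumes "exp_decaying f" "exp_decaying g"
  shows "exp_decaying (\<lambda>t. f t + g t)"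
proof -
  obtain K c where f: "continuous_on {0..} f" and c: "c > 0"
    and K: "\<And>t. t \<ge> 0 \<Longrightarrow> norm (f t) \<le> K * exp (- c * t)"
    using assms(1) unfolding exp_decaying_def by blast
  obtain L d where g: "continuous_on {0..} g" and d: "d > 0"
    and L: "\<And>t. t \<ge> 0 \<Longrightarrow> norm (g t) \<le> L * exp (- d * t)"
    using assms(2) unfolding exp_decaying_def by blast
  have KL: "0 \<le> K" "0 \<le> L"
    using order_trans[OF norm_ge_zero K[of 0]] order_trans[OF norm_ge_zero L[of 0]] by simp_all
  have "norm (f t + g t) \<le> (K + L) * exp (- min c d * t)" if t: "t \<ge> 0" for t
  proof -
    have "- c * t \<le> - min c d * t" "- d * t \<le> - min c d * t"
      using t by (intro mult_right_mono; simp)+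
    then have "K * exp (- c * t) \<le> K * exp (- min c d * t)"
      "L * exp (- d * t) \<le> L * exp (- min c d * t)"
      using KL by (intro mult_left_mono; simp)+
    then show ?thesis
      using K[OF t] L[OF t] norm_triangle_ineq[of "f t" "g t"] unfolding distrib_right by linarith
  qed
  then show ?thesis
    using f g c d unfolding exp_decaying_def
    by (intro conjI exI[of _ "K + L"] exI[of _ "min c d"]) (auto intro!: continuous_intros)
qed

text \<open>
  This compares the two integration theories where it is elementary: a simple function is a finite sum of
  indicators of sets of finite measure.
\<close>

lemma simple_bochner_integral_has_integral:
  fixes s :: "'a::euclidean_space \<Rightarrow> 'b::real_normed_vector"
  assumes s: "Bochner_Integration.simple_bochner_integrable (lebesgue_on S) s"
    and S: "S \<in> sets lebesgue"
  shows "(s has_integral Bochner_Integration.simple_bochner_integral (lebesgue_on S) s) S"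
proof -
  have sf: "simple_function (lebesgue_on S) s"
    and fin: "emeasure (lebesgue_on S) {t \<in> space (lebesgue_on S). s t \<noteq> 0} \<noteq> \<infinity>"
    using s by (auto elim: simple_bochner_integrable.cases)
  have sp: "space (lebesgue_on S) = S" by (simp add: space_restrict_space)
  have fini: "finite (s ` S)" using simple_functionD(1)[OF sf] by (simp add: sp)
  have lev: "{t \<in> S. s t = y} \<in> sets (lebesgue_on S)" for y
    using simple_functionD(2)[OF sf, of "{y}"]
    by (simp add: sp vimage_def Int_def conj_commute)
  have term_y: "((\<lambda>t. indicator {t \<in> S. s t = y} t *\<^sub>R y) has_integral
      measure (lebesgue_on S) {t \<in> S. s t = y} *\<^sub>R y) S" for y
  proof (cases "y = 0")
    case False
    let ?E = "{t \<in> S. s t = y}"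
    have "{t \<in> S. s t \<noteq> 0} = S - s -` {0} \<inter> S" by auto
    then have ne0: "{t \<in> S. s t \<noteq> 0} \<in> sets (lebesgue_on S)"
      using simple_functionD(2)[OF sf, of "{0}"] sets.compl_sets[of "s -` {0} \<inter> S" "lebesgue_on S"]
      by (simp add: sp)
    have "emeasure (lebesgue_on S) ?E \<le> emeasure (lebesgue_on S) {t \<in> S. s t \<noteq> 0}"
      using False ne0 by (intro emeasure_mono) auto
    also have "\<dots> < \<infinity>" using fin by (simp add: sp top.not_eq_extremum)
    finally have "emeasure lebesgue ?E < \<infinity>"
      using S by (subst (asm) emeasure_restrict_space) auto
    moreover have "?E \<in> sets lebesgue"
      using lev S by (auto simp: sets_restrict_space_iff)
    ultimately have "?E \<in> lmeasurable" by (simp add: fmeasurable_def)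
    then have "(indicat_real ?E has_integral measure lebesgue ?E) UNIV"
      by (simp add: lmeasurable_iff_has_integral)
    then have "(indicat_real ?E has_integral measure lebesgue ?E) S"
      by (subst has_integral_restrict_UNIV[symmetric], rule has_integral_eq[rotated])
        (auto simp: indicator_def)
    moreover have "measure (lebesgue_on S) ?E = measure lebesgue ?E"
      using S by (intro measure_restrict_space) auto
    ultimately show ?thesis by (simp add: has_integral_scaleR_left)
  qed simp
  have "((\<lambda>t. \<Sum>y\<in>s ` S. indicator {t \<in> S. s t = y} t *\<^sub>R y) has_integral
      (\<Sum>y\<in>s ` S. measure (lebesgue_on S) {t \<in> S. s t = y} *\<^sub>R y)) S"
    using fini term_y by (intro has_integral_sum) auto
  moreover have "(\<Sum>y\<in>s ` S. indicator {t \<in> S. s t = y} t *\<^sub>R y) = s t" if "t \<in> S" for t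
  proof -
    have "(\<Sum>y\<in>s ` S. indicator {t \<in> S. s t = y} t *\<^sub>R y) = (\<Sum>y\<in>s ` S. if y = s t then y else 0)"
      using that by (intro sum.cong) (auto simp: indicator_def)
    then show ?thesis using fini that by simp
  qed
  ultimately show ?thesis
    unfolding simple_bochner_integral_def sp
    by (subst has_integral_cong[of S s "\<lambda>t. \<Sum>y\<in>s ` S. indicator {t \<in> S. s t = y} t *\<^sub>R y"]) auto
qed

text \<open>
  By uniform continuity on \<open>{0..n}\<close>, sampling \<open>f\<close> at the multiples of a small mesh width
  is uniformly accurate there.
\<close>

lemma step_function_approximation:
  fixes f :: "real \<Rightarrow> 'b::real_normed_vector"
  assumes f: "continuous_on {0..} f" and e: "e > 0"
  obtains s where "Bochner_Integration.simple_bochner_integrable (lebesgue_on {0..}) s"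
    "\<And>t. 0 \<le> t \<Longrightarrow> t < real n \<Longrightarrow> norm (f t - s t) \<le> e"
    "\<And>t. real n \<le> t \<Longrightarrow> s t = 0"
proof -
  have "uniformly_continuous_on {0..real n} f"
    using f by (intro compact_uniformly_continuous) (auto intro: continuous_on_subset)
  then obtain d where d: "d > 0"
    "\<And>t u. t \<in> {0..real n} \<Longrightarrow> u \<in> {0..real n} \<Longrightarrow> dist u t < d \<Longrightarrow> dist (f u) (f t) < e"
    using e unfolding uniformly_continuous_on_def by blast
  \<comment> \<open>The sample point of \<open>t\<close>, with \<open>-1\<close> marking the region where the step function vanishes.\<close>
  define r where "r t = (if t < real n then d * real_of_int \<lfloor>t / d\<rfloor> else -1)" for t
  define s where "s = (\<lambda>u. if u = -1 then 0 else f u) \<circ> r"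
  let ?L = "lebesgue_on {0..} :: real measure"
  have sp: "space ?L = {0..}" by (simp add: space_restrict_space)
  have r0: "0 \<le> r t" "r t \<le> t" "t - r t < d" if "0 \<le> t" "t < real n" for t
  proof -
    have *: "real_of_int \<lfloor>t / d\<rfloor> \<le> t / d" "t / d < real_of_int \<lfloor>t / d\<rfloor> + 1" by linarith+
    show "0 \<le> r t" using that d(1) by (simp add: r_def)
    have "d * real_of_int \<lfloor>t / d\<rfloor> \<le> d * (t / d)"
      "d * (t / d) < d * (real_of_int \<lfloor>t / d\<rfloor> + 1)"
      using d(1) * by (intro mult_left_mono mult_strict_left_mono; simp)+
    then show "r t \<le> t" "t - r t < d"
      using that d(1) by (simp_all add: r_def algebra_simps)
  qed
  have "r ` {0..} \<subseteq> insert (-1) ((\<lambda>k. d * real_of_int k) ` {0..\<lfloor>real n / d\<rfloor>})"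
  proof
    fix u assume "u \<in> r ` {0..}"
    then obtain t where t: "t \<ge> 0" "u = r t" by auto
    show "u \<in> insert (-1) ((\<lambda>k. d * real_of_int k) ` {0..\<lfloor>real n / d\<rfloor>})"
      using t d(1) by (auto simp: r_def intro!: imageI floor_mono divide_right_mono)
  qed
  then have "finite (r ` {0..})" by (rule finite_subset) auto
  moreover have "r \<in> borel_measurable lebesgue"
    unfolding r_def by (intro measurable_completion) measurable
  then have "r \<in> borel_measurable ?L" by (rule measurable_restrict_space1)
  ultimately have "simple_function ?L r"
    by (intro simple_function_borel_measurable) (auto simp: sp)
  then have "simple_function ?L s" unfolding s_def by (rule simple_function_compose)
  have s0: "s t = 0" if "real n \<le> t" for t using that by (simp add: s_def r_def)
  moreover have "emeasure ?L {t \<in> space ?L. s t \<noteq> 0} \<noteq> \<infinity>"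
  proof -
    have "{t \<in> space ?L. s t \<noteq> 0} \<subseteq> {0..real n}"
      using s0 by (auto simp: sp) (meson linear)
    then have "emeasure ?L {t \<in> space ?L. s t \<noteq> 0} \<le> emeasure ?L {0..real n}"
      by (intro emeasure_mono) (auto simp: sets_restrict_space_iff)
    also have "\<dots> = emeasure lebesgue {0..real n}" by (intro emeasure_restrict_space) auto
    also have "\<dots> < \<infinity>" by simp
    finally show ?thesis by simp
  qed
  ultimately have "Bochner_Integration.simple_bochner_integrable ?L s"
    using \<open>simple_function ?L s\<close> by (intro simple_bochner_integrable.intros)
  moreover have "norm (f t - s t) \<le> e" if "0 \<le> t" "t < real n" for t
  proof -
    have "s t = f (r t)" using r0[OF that] by (simp add: s_def)
    moreover have "dist (f t) (f (r t)) < e"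
      using r0[OF that] that by (intro d(2)) (auto simp: dist_real_def)
    ultimately show ?thesis by (simp add: dist_norm)
  qed
  ultimately show ?thesis using s0 by (intro that)
qed

text \<open>
  Take step functions that approximate \<open>f\<close> on \<open>{0..<n}\<close> up to $e^{-n}$ and vanish beyond \<open>n\<close>.
  Their $L^1$ distance to \<open>f\<close> is at most $n e^{-n}$ plus the tail of the majorant, and their integrals differ
  from the integral of \<open>f\<close> over \<open>{0..n}\<close> by at most $n e^{-n}$.
\<close>

lemma has_improper_integral_imp_has_bochner:
  fixes f :: "real \<Rightarrow> 'b::banach"
  assumes f: "exp_decaying f" and I: "has_improper_integral f I"
  shows "has_bochner (lebesgue_on {0..}) f I"
proof -
  let ?L = "lebesgue_on {0..} :: real measure"
  let ?S = "Bochner_Integration.simple_bochner_integral ?L"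
  obtain K c where cont: "continuous_on {0..} f" and c: "c > 0"
    and K: "\<And>t. t \<ge> 0 \<Longrightarrow> norm (f t) \<le> K * exp (- c * t)"
    using f unfolding exp_decaying_def by blast
  have K0: "0 \<le> K" using order_trans[OF norm_ge_zero K[of 0]] by simp
  have sp: "space ?L = {0..}" by (simp add: space_restrict_space)
  have "\<exists>s. Bochner_Integration.simple_bochner_integrable ?L s \<and>
      (\<forall>t. 0 \<le> t \<and> t < real n \<longrightarrow> norm (f t - s t) \<le> exp (- real n)) \<and> (\<forall>t\<ge>real n. s t = 0)" for n
    using step_function_approximation[OF cont, of "exp (- real n)" n] by (metis exp_gt_zero)
  then obtain s where s: "\<And>n. Bochner_Integration.simple_bochner_integrable ?L (s n)"
    and s1: "\<And>n t. 0 \<le> t \<Longrightarrow> t < real n \<Longrightarrow> norm (f t - s n t) \<le> exp (- real n)"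
    and s2: "\<And>n t. real n \<le> t \<Longrightarrow> s n t = 0"
    by metis
  have meas: "f \<in> borel_measurable ?L"
  proof -
    have "f \<in> borel_measurable (restrict_space borel {0..})"
      using cont by (rule borel_measurable_continuous_on_restrict)
    then show ?thesis
      unfolding measurable_def by (auto simp: space_restrict_space sets_restrict_space)
  qed
  have lim1: "(\<lambda>n. real n * exp (- real n)) \<longlonglongrightarrow> 0" by real_asymp
  have lim2: "(\<lambda>n. K / c * exp (- c * real n)) \<longlonglongrightarrow> 0" using c by real_asymp
  have err: "(\<integral>\<^sup>+ t. norm (f t - s n t) \<partial>?L)
      \<le> ennreal (real n * exp (- real n) + K / c * exp (- c * real n))" for n
  proof -
    let ?g = "\<lambda>t. ennreal (exp (- real n)) * indicator {0..real n} t
      + ennreal (K * exp (- c * t)) * indicator {real n..} t"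
    have "(\<integral>\<^sup>+ t. norm (f t - s n t) \<partial>?L) \<le> (\<integral>\<^sup>+ t. ?g t \<partial>?L)"
    proof (rule nn_integral_mono)
      fix t :: real assume "t \<in> space ?L"
      then have t: "t \<ge> 0" by (simp add: sp)
      show "ennreal (norm (f t - s n t)) \<le> ?g t"
      proof (cases "t < real n")
        case True
        then show ?thesis using s1[OF t True] t by (simp add: ennreal_leI)
      next
        case False
        then have "ennreal (norm (f t - s n t)) \<le> ennreal (K * exp (- c * t))"
          using s2 K[OF t] by (simp add: ennreal_leI)
        then show ?thesis using False by (simp add: add_increasing)
      qed
    qed
    also have "\<dots> \<le> (\<integral>\<^sup>+ t. ?g t \<partial>lborel)"
    proof -
      have "(\<integral>\<^sup>+ t. ?g t \<partial>?L) = (\<integral>\<^sup>+ t. ?g t * indicator {0..} t \<partial>lebesgue)"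
        by (subst nn_integral_restrict_space) auto
      also have "\<dots> \<le> (\<integral>\<^sup>+ t. ?g t \<partial>lebesgue)"
        by (intro nn_integral_mono) (auto simp: indicator_def)
      also have "\<dots> = (\<integral>\<^sup>+ t. ?g t \<partial>lborel)" by (rule nn_integral_completion)
      finally show ?thesis .
    qed
    also have "\<dots> = (\<integral>\<^sup>+ t. ennreal (exp (- real n)) * indicator {0..real n} t \<partial>lborel)
        + (\<integral>\<^sup>+ t. ennreal (K * exp (- c * t)) * indicator {real n..} t \<partial>lborel)"
      by (intro nn_integral_add) auto
    also have "(\<integral>\<^sup>+ t. ennreal (exp (- real n)) * indicator {0..real n} t \<partial>lborel)
        = ennreal (real n * exp (- real n))"
      by (subst nn_integral_cmult_indicator) (auto simp: ennreal_mult'[symmetric] mult.commute)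
    also have "(\<integral>\<^sup>+ t. ennreal (K * exp (- c * t)) * indicator {real n..} t \<partial>lborel)
        = ennreal (0 - (- K / c * exp (- c * real n)))"
    proof (rule nn_integral_FTC_atLeast)
      show "((\<lambda>t. - K / c * exp (- c * t)) \<longlongrightarrow> 0) at_top" using c by real_asymp
    qed (use c K0 in \<open>auto intro!: derivative_eq_intros\<close>)
    finally show ?thesis using c K0 by (simp flip: ennreal_plus)
  qed
  have "(\<lambda>n. \<integral>\<^sup>+ t. norm (f t - s n t) \<partial>?L) \<longlonglongrightarrow> 0"
  proof (rule tendsto_sandwich[OF _ _ tendsto_const])
    show "(\<lambda>n. ennreal (real n * exp (- real n) + K / c * exp (- c * real n))) \<longlonglongrightarrow> 0"
      using tendsto_ennrealI[OF tendsto_add[OF lim1 lim2]] by simp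
  qed (use err in auto)
  moreover have "(\<lambda>n. ?S (s n)) \<longlonglongrightarrow> I"
  proof -
    have le: "norm (?S (s n) - integral {0..real n} f) \<le> real n * exp (- real n)" for n
    proof -
      have "(s n has_integral ?S (s n)) {0..}"
        using s by (intro simple_bochner_integral_has_integral) auto
      then have "((\<lambda>t. if t \<in> {0..real n} then s n t else 0) has_integral ?S (s n)) {0..}"
        by (rule has_integral_eq[rotated]) (use s2 in auto)
      then have "(s n has_integral ?S (s n)) {0..real n}"
        by (subst (asm) has_integral_restrict) auto
      moreover have "(f has_integral integral {0..real n} f) {0..real n}"
        using cont by (intro integrable_integral integrable_on_half_line) auto
      ultimately have *: "((\<lambda>t. s n t - f t) has_integral ?S (s n) - integral {0..real n} f)
          {0..real n}"
        by (rule has_integral_diff)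
      \<comment> \<open>The right end point, where the step function has already dropped to \<open>0\<close>, is a null set.\<close>
      then have "((\<lambda>t. if t = real n then 0 else s n t - f t) has_integral
          ?S (s n) - integral {0..real n} f) (cbox 0 (real n))"
        unfolding box_real(2)
        by (rule has_integral_spike_finite[of "{real n}", rotated 2]) auto
      then have "norm (?S (s n) - integral {0..real n} f)
          \<le> exp (- real n) * measure lborel (cbox 0 (real n))"
        by (rule has_integral_bound[rotated]) (auto intro: s1 simp: norm_minus_commute)
      then show ?thesis by (simp add: mult.commute)
    qed
    have "(\<lambda>n. ?S (s n) - integral {0..real n} f) \<longlonglongrightarrow> 0"
      by (rule Lim_null_comparison[OF always_eventually lim1]) (use le in auto)
    moreover have "(\<lambda>n. integral {0..real n} f) \<longlonglongrightarrow> I"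
      using I unfolding has_improper_integral_def
      by (rule filterlim_compose[OF _ filterlim_real_sequentially])
    ultimately show ?thesis using tendsto_add by fastforce
  qed
  ultimately show ?thesis
    unfolding has_bochner_def using meas s by blast
qed

section \<open>Weighted orbit integrals of a semigroup\<close>

lemma has_vector_derivative_at_right_quotient:
  fixes F :: "real \<Rightarrow> 'b::real_normed_vector"
  assumes "(F has_vector_derivative D) (at_right 0)"
  shows "((\<lambda>h. (F h - F 0) /\<^sub>R h) \<longlongrightarrow> D) (at_right 0)"
proof -
  have "((\<lambda>h. (1 / norm (h - 0)) *\<^sub>R (F h - (F 0 + (h - 0) *\<^sub>R D))) \<longlongrightarrow> 0) (at_right 0)"
    using assms by (simp add: has_vector_derivative_def has_derivative_within)
  moreover have "\<forall>\<^sub>F h in at_right 0. (1 / norm (h - 0)) *\<^sub>R (F h - (F 0 + (h - 0) *\<^sub>R D))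
      = (F h - F 0) /\<^sub>R h - D"
    using eventually_at_right_less[of "0::real"]
    by eventually_elim (simp add: scaleR_diff_right scaleR_add_right divide_inverse_commute)
  ultimately have "((\<lambda>h. (F h - F 0) /\<^sub>R h - D) \<longlongrightarrow> 0) (at_right 0)"
    by (rule Lim_transform_eventually)
  then show ?thesis by (simp add: LIM_zero_iff)
qed

text \<open>
  The part of the problem that does not involve the Clifford algebra: a strongly continuous semigroup on
  a real Banach space with a growth bound.
\<close>

locale exp_bounded_semigroup =
  fixes T :: "real \<Rightarrow> 'x::banach \<Rightarrow> 'x" and M \<omega> :: real
  assumes bounded_linear_T: "t \<ge> 0 \<Longrightarrow> bounded_linear (T t)"
    and continuous_orbit: "continuous_on {0..} (\<lambda>t. T t x)"
    and T_add: "t \<ge> 0 \<Longrightarrow> s \<ge> 0 \<Longrightarrow> T (t + s) x = T t (T s x)"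
    and T_zero: "T 0 x = x"
    and norm_T_le: "t \<ge> 0 \<Longrightarrow> norm (T t x) \<le> M * exp (\<omega> * t) * norm x"
begin

lemma T_scaleR: "t \<ge> 0 \<Longrightarrow> T t (r *\<^sub>R x) = r *\<^sub>R T t x"
  by (rule linear_cmul[OF bounded_linear.linear[OF bounded_linear_T]])

lemma T_plus: "t \<ge> 0 \<Longrightarrow> T t (x + y) = T t x + T t y"
  by (rule linear_add[OF bounded_linear.linear[OF bounded_linear_T]])

text \<open>
  The rate \<open>c\<close> exceeds the growth bound strictly, so that a weighted orbit decays exponentially.
\<close>

definition weight :: "(real \<Rightarrow> real) \<Rightarrow> bool" where
  "weight \<phi> \<longleftrightarrow> continuous_on {0..} \<phi> \<and> (\<exists>K c. c > \<omega> \<and> (\<forall>t\<ge>0. \<bar>\<phi> t\<bar> \<le> K * exp (- c * t)))"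

definition orbit_integral :: "(real \<Rightarrow> real) \<Rightarrow> 'x \<Rightarrow> 'x" where
  "orbit_integral \<phi> x = (THE I. has_improper_integral (\<lambda>t. \<phi> t *\<^sub>R T t x) I)"

lemma continuous_weighted_orbit: "weight \<phi> \<Longrightarrow> continuous_on {0..} (\<lambda>t. \<phi> t *\<^sub>R T t x)"
  unfolding weight_def by (intro continuous_on_scaleR continuous_orbit) auto

lemma exp_decaying_weighted_orbit:
  assumes "weight \<phi>"
  shows "exp_decaying (\<lambda>t. \<phi> t *\<^sub>R T t x)"
proof -
  obtain K c where c: "c > \<omega>" and K: "\<And>t. t \<ge> 0 \<Longrightarrow> \<bar>\<phi> t\<bar> \<le> K * exp (- c * t)"
    using assms unfolding weight_def by blast
  have "norm (\<phi> t *\<^sub>R T t x) \<le> (K * M * norm x) * exp (- (c - \<omega>) * t)" if t: "t \<ge> 0" for t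
  proof -
    have "norm (\<phi> t *\<^sub>R T t x) \<le> (K * exp (- c * t)) * (M * exp (\<omega> * t) * norm x)"
      unfolding norm_scaleR using K[OF t] norm_T_le[OF t]
      by (rule mult_mono) (use order_trans[OF abs_ge_zero K[OF t]] in auto)
    also have "\<dots> = (K * M * norm x) * exp (- (c - \<omega>) * t)"
      by (simp add: algebra_simps flip: exp_add)
    finally show ?thesis .
  qed
  then show ?thesis
    using c continuous_weighted_orbit[OF assms] unfolding exp_decaying_def
    by (intro conjI exI[of _ "K * M * norm x"] exI[of _ "c - \<omega>"]) auto
qed

lemma has_orbit_integral:
  assumes "weight \<phi>"
  shows "has_improper_integral (\<lambda>t. \<phi> t *\<^sub>R T t x) (orbit_integral \<phi> x)"
  unfolding orbit_integral_def
  using exp_decaying_has_improper_integral[OF exp_decaying_weighted_orbit[OF assms]]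
  by (metis has_improper_integral_unique theI')

lemma orbit_integral_eqI:
  assumes "weight \<phi>" "has_improper_integral (\<lambda>t. \<phi> t *\<^sub>R T t x) I"
  shows "orbit_integral \<phi> x = I"
  using has_improper_integral_unique[OF has_orbit_integral assms(2)] assms(1) by blast

text \<open>
  Applied to right scalar multiplications this gives right linearity, and applied to \<open>T s\<close> it makes
  the operator \<open>orbit_integral \<phi>\<close> commute with the generator.
\<close>

lemma orbit_integral_commute:
  assumes "weight \<phi>" "bounded_linear G" "\<And>t. t \<ge> 0 \<Longrightarrow> G (T t x) = T t (G x)"
  shows "orbit_integral \<phi> (G x) = G (orbit_integral \<phi> x)"
proof (rule orbit_integral_eqI[OF assms(1)])
  have "has_improper_integral (\<lambda>t. G (\<phi> t *\<^sub>R T t x)) (G (orbit_integral \<phi> x))"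
    by (rule has_improper_integral_linear[OF continuous_weighted_orbit[OF assms(1)]
          has_orbit_integral[OF assms(1)] assms(2)])
  then show "has_improper_integral (\<lambda>t. \<phi> t *\<^sub>R T t (G x)) (G (orbit_integral \<phi> x))"
    by (rule has_improper_integral_cong[THEN iffD1, rotated])
      (simp add: assms(3) linear_scale[OF bounded_linear.linear[OF assms(2)]])
qed

lemma orbit_integral_scaleR:
  assumes "weight \<phi>"
  shows "orbit_integral \<phi> (r *\<^sub>R x) = r *\<^sub>R orbit_integral \<phi> x"
  using assms
  by (intro orbit_integral_commute[where G = "\<lambda>x. r *\<^sub>R x"] bounded_linear_scaleR_right)
    (simp_all add: T_scaleR)

lemma orbit_integral_add:
  assumes "weight \<phi>"
  shows "orbit_integral \<phi> (x + y) = orbit_integral \<phi> x + orbit_integral \<phi> y"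
proof (rule orbit_integral_eqI[OF assms(1)])
  have "has_improper_integral (\<lambda>t. \<phi> t *\<^sub>R T t x + \<phi> t *\<^sub>R T t y)
      (orbit_integral \<phi> x + orbit_integral \<phi> y)"
    using assms by (intro has_improper_integral_add continuous_weighted_orbit has_orbit_integral)
  then show "has_improper_integral (\<lambda>t. \<phi> t *\<^sub>R T t (x + y))
      (orbit_integral \<phi> x + orbit_integral \<phi> y)"
    by (rule has_improper_integral_cong[THEN iffD1, rotated])
      (simp add: T_plus scaleR_add_right)
qed

text \<open>
  \<open>T h\<close> translates the orbit, $\mathsf{T}(h)\int_0^\infty \varphi(t)\mathsf{T}(t)x\,dt = \int_h^\infty
  \varphi(u-h)\mathsf{T}(u)x\,du$.  If the translated weight is a combination of \<open>\<phi>\<close> and \<open>\<psi>\<close>,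
  the right hand side is a combination of two fixed integrals with their initial pieces removed.
\<close>

lemma T_orbit_integral:
  assumes \<phi>: "weight \<phi>" and \<psi>: "weight \<psi>" and h: "h \<ge> 0"
    and shift: "\<And>t. t \<ge> 0 \<Longrightarrow> \<phi> t = \<alpha> * \<phi> (t + h) + \<beta> * \<psi> (t + h)"
  shows "T h (orbit_integral \<phi> x) =
    \<alpha> *\<^sub>R (orbit_integral \<phi> x - integral {0..h} (\<lambda>t. \<phi> t *\<^sub>R T t x)) +
    \<beta> *\<^sub>R (orbit_integral \<psi> x - integral {0..h} (\<lambda>t. \<psi> t *\<^sub>R T t x))" (is "_ = ?R")
proof (rule has_improper_integral_unique)
  show "has_improper_integral (\<lambda>t. T h (\<phi> t *\<^sub>R T t x)) (T h (orbit_integral \<phi> x))"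
    by (rule has_improper_integral_linear[OF continuous_weighted_orbit[OF \<phi>]
          has_orbit_integral[OF \<phi>] bounded_linear_T[OF h]])
  have tail: "has_improper_integral (\<lambda>t. c *\<^sub>R (\<eta> (t + h) *\<^sub>R T (t + h) x))
      (c *\<^sub>R (orbit_integral \<eta> x - integral {0..h} (\<lambda>t. \<eta> t *\<^sub>R T t x)))"
    and cont: "continuous_on {0..} (\<lambda>t. c *\<^sub>R (\<eta> (t + h) *\<^sub>R T (t + h) x))"
    if "weight \<eta>" for \<eta> c
  proof -
    have c1: "continuous_on {0..} (\<lambda>t. \<eta> (t + h) *\<^sub>R T (t + h) x)"
      using h by (intro continuous_on_compose2[OF continuous_weighted_orbit[OF that],
            where f = "\<lambda>t. t + h"]) (auto intro!: continuous_intros)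
    then show "continuous_on {0..} (\<lambda>t. c *\<^sub>R (\<eta> (t + h) *\<^sub>R T (t + h) x))"
      by (rule continuous_on_scaleR[OF continuous_on_const])
    show "has_improper_integral (\<lambda>t. c *\<^sub>R (\<eta> (t + h) *\<^sub>R T (t + h) x))
      (c *\<^sub>R (orbit_integral \<eta> x - integral {0..h} (\<lambda>t. \<eta> t *\<^sub>R T t x)))"
      using c1 has_improper_integral_shift[OF continuous_weighted_orbit[OF that]
          has_orbit_integral[OF that] h]
      by (rule has_improper_integral_linear) (rule bounded_linear_scaleR_right)
  qed
  have "T h (\<phi> t *\<^sub>R T t x) = \<alpha> *\<^sub>R (\<phi> (t + h) *\<^sub>R T (t + h) x) + \<beta> *\<^sub>R (\<psi> (t + h) *\<^sub>R T (t + h) x)"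
    if t: "t \<ge> 0" for t
  proof -
    have "T h (\<phi> t *\<^sub>R T t x) = \<phi> t *\<^sub>R T (t + h) x"
      using h t T_add[OF h t, of x]
      by (simp add: T_scaleR add.commute)
    then show ?thesis by (simp add: shift[OF t] scaleR_add_left)
  qed
  moreover have "has_improper_integral (\<lambda>t. \<alpha> *\<^sub>R (\<phi> (t + h) *\<^sub>R T (t + h) x)
      + \<beta> *\<^sub>R (\<psi> (t + h) *\<^sub>R T (t + h) x)) ?R"
    by (rule has_improper_integral_add[OF cont[OF \<phi>] tail[OF \<phi>] cont[OF \<psi>] tail[OF \<psi>]])
  ultimately show "has_improper_integral (\<lambda>t. T h (\<phi> t *\<^sub>R T t x)) ?R"
    by (rule has_improper_integral_cong[THEN iffD2])
qed

lemma generatorI: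
  assumes "((\<lambda>h. (T h x - x) /\<^sub>R h) \<longlongrightarrow> y) (at_right 0)"
  shows "x \<in> generator_domain T" "generator T x = y"
  using assms by (auto simp: generator_domain_def generator_def intro!: tendsto_Lim)

lemma combine_generator:
  assumes "x \<in> generator_domain T" "y \<in> generator_domain T"
  shows "r *\<^sub>R x + s *\<^sub>R y \<in> generator_domain T"
    and "generator T (r *\<^sub>R x + s *\<^sub>R y) = r *\<^sub>R generator T x + s *\<^sub>R generator T y"
proof -
  obtain u v where u: "((\<lambda>h. (T h x - x) /\<^sub>R h) \<longlongrightarrow> u) (at_right 0)"
    and v: "((\<lambda>h. (T h y - y) /\<^sub>R h) \<longlongrightarrow> v) (at_right 0)"
    using assms by (auto simp: generator_domain_def)
  have "((\<lambda>h. r *\<^sub>R ((T h x - x) /\<^sub>R h) + s *\<^sub>R ((T h y - y) /\<^sub>R h)) \<longlongrightarrow> r *\<^sub>R u + s *\<^sub>R v) (at_right 0)"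
    using u v by (intro tendsto_add tendsto_scaleR tendsto_const)
  moreover have "\<forall>\<^sub>F h in at_right 0. r *\<^sub>R ((T h x - x) /\<^sub>R h) + s *\<^sub>R ((T h y - y) /\<^sub>R h)
      = (T h (r *\<^sub>R x + s *\<^sub>R y) - (r *\<^sub>R x + s *\<^sub>R y)) /\<^sub>R h"
    using eventually_at_right_less[of "0::real"]
    by eventually_elim (simp add: T_scaleR T_plus algebra_simps)
  ultimately have "((\<lambda>h. (T h (r *\<^sub>R x + s *\<^sub>R y) - (r *\<^sub>R x + s *\<^sub>R y)) /\<^sub>R h)
      \<longlongrightarrow> r *\<^sub>R u + s *\<^sub>R v) (at_right 0)"
    by (rule Lim_transform_eventually)
  then show "r *\<^sub>R x + s *\<^sub>R y \<in> generator_domain T"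
    "generator T (r *\<^sub>R x + s *\<^sub>R y) = r *\<^sub>R generator T x + s *\<^sub>R generator T y"
    using generatorI(2)[OF u] generatorI(2)[OF v] by (auto dest: generatorI)
qed

text \<open>
  In the formula of \<open>T_orbit_integral\<close> only the coefficients and the integrals over \<open>{0..h}\<close>
  depend on \<open>h\<close>, and all of these are differentiable at \<open>0\<close>.
\<close>

lemma generator_orbit_integral:
  assumes \<phi>: "weight \<phi>" and \<psi>: "weight \<psi>"
    and shift: "\<And>t h. t \<ge> 0 \<Longrightarrow> h \<ge> 0 \<Longrightarrow> \<phi> t = \<alpha> h * \<phi> (t + h) + \<beta> h * \<psi> (t + h)"
    and \<alpha>: "\<alpha> 0 = 1" "(\<alpha> has_real_derivative \<alpha>') (at 0)"
    and \<beta>: "\<beta> 0 = 0" "(\<beta> has_real_derivative \<beta>') (at 0)"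
  shows "orbit_integral \<phi> x \<in> generator_domain T"
    and "generator T (orbit_integral \<phi> x) =
      \<alpha>' *\<^sub>R orbit_integral \<phi> x + \<beta>' *\<^sub>R orbit_integral \<psi> x - \<phi> 0 *\<^sub>R x"
proof -
  let ?J = "\<lambda>\<eta>. orbit_integral \<eta> x" and ?F = "\<lambda>\<eta> h. integral {0..h} (\<lambda>t. \<eta> t *\<^sub>R T t x)"
  define G where "G h = \<alpha> h *\<^sub>R (?J \<phi> - ?F \<phi> h) + \<beta> h *\<^sub>R (?J \<psi> - ?F \<psi> h)" for h
  have F': "(?F \<eta> has_vector_derivative \<eta> 0 *\<^sub>R x) (at_right 0)" if "weight \<eta>" for \<eta>
  proof -
    have "(?F \<eta> has_vector_derivative \<eta> 0 *\<^sub>R T 0 x) (at 0 within {0..1})"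
      by (rule integral_has_vector_derivative)
        (auto intro: continuous_on_subset[OF continuous_weighted_orbit[OF that]])
    then show ?thesis by (simp add: T_zero at_within_Icc_at_right)
  qed
  have "(G has_vector_derivative
      (\<alpha> 0 *\<^sub>R (0 - \<phi> 0 *\<^sub>R x) + \<alpha>' *\<^sub>R (?J \<phi> - ?F \<phi> 0)) +
      (\<beta> 0 *\<^sub>R (0 - \<psi> 0 *\<^sub>R x) + \<beta>' *\<^sub>R (?J \<psi> - ?F \<psi> 0))) (at_right 0)"
    unfolding G_def using \<alpha>(2) \<beta>(2)
    by (intro has_vector_derivative_add has_vector_derivative_scaleR has_vector_derivative_diff
        has_vector_derivative_const F' \<phi> \<psi>) (auto intro: has_field_derivative_at_within)
  then have "(G has_vector_derivative \<alpha>' *\<^sub>R ?J \<phi> + \<beta>' *\<^sub>R ?J \<psi> - \<phi> 0 *\<^sub>R x) (at_right 0)"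
    by (simp add: \<alpha>(1) \<beta>(1) algebra_simps)
  then have lim: "((\<lambda>h. (G h - G 0) /\<^sub>R h) \<longlongrightarrow> \<alpha>' *\<^sub>R ?J \<phi> + \<beta>' *\<^sub>R ?J \<psi> - \<phi> 0 *\<^sub>R x) (at_right 0)"
    by (rule has_vector_derivative_at_right_quotient)
  have "G 0 = ?J \<phi>" by (simp add: G_def \<alpha>(1) \<beta>(1))
  moreover have "G h = T h (?J \<phi>)" if "h > 0" for h
    unfolding G_def using that by (intro T_orbit_integral[symmetric] \<phi> \<psi> shift) auto
  ultimately have "\<forall>\<^sub>F h in at_right 0. (G h - G 0) /\<^sub>R h = (T h (?J \<phi>) - ?J \<phi>) /\<^sub>R h"
    using eventually_at_right_less[of "0::real"] by (auto elim: eventually_mono)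
  with lim have "((\<lambda>h. (T h (?J \<phi>) - ?J \<phi>) /\<^sub>R h)
      \<longlongrightarrow> \<alpha>' *\<^sub>R ?J \<phi> + \<beta>' *\<^sub>R ?J \<psi> - \<phi> 0 *\<^sub>R x) (at_right 0)"
    by (rule Lim_transform_eventually)
  then show "?J \<phi> \<in> generator_domain T"
    "generator T (?J \<phi>) = \<alpha>' *\<^sub>R ?J \<phi> + \<beta>' *\<^sub>R ?J \<psi> - \<phi> 0 *\<^sub>R x"
    by (rule generatorI)+
qed

lemma generator_commute:
  assumes x: "x \<in> generator_domain T" and B: "bounded_linear B"
    and comm: "\<And>t y. t \<ge> 0 \<Longrightarrow> B (T t y) = T t (B y)"
  shows "generator T (B x) = B (generator T x)"
proof (rule generatorI(2))
  obtain y where y: "((\<lambda>h. (T h x - x) /\<^sub>R h) \<longlongrightarrow> y) (at_right 0)"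
    using x by (auto simp: generator_domain_def)
  then have "generator T x = y" by (rule generatorI)
  with y have "((\<lambda>h. B ((T h x - x) /\<^sub>R h)) \<longlongrightarrow> B (generator T x)) (at_right 0)"
    by (intro bounded_linear.tendsto[OF B]) simp
  moreover have "\<forall>\<^sub>F h in at_right 0. B ((T h x - x) /\<^sub>R h) = (T h (B x) - B x) /\<^sub>R h"
    using eventually_at_right_less[of "0::real"]
  proof eventually_elim
    case (elim h)
    then show ?case
      by (simp add: linear_scale[OF bounded_linear.linear[OF B]]
          linear_diff[OF bounded_linear.linear[OF B]] comm)
  qed
  ultimately show "((\<lambda>h. (T h (B x) - B x) /\<^sub>R h) \<longlongrightarrow> B (generator T x)) (at_right 0)"
    by (rule Lim_transform_eventually)
qed

end

section \<open>Damped oscillations\<close>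

text \<open>
  The solution of $y'' = -b^2 y$, $y(0) = 0$, $y'(0) = 1$, which is $\sin(bt)/b$ for $b \ne 0$ and $t$ for
  $b = 0$.  This form treats both cases at once.
\<close>

definition times_sinc :: "real \<Rightarrow> real \<Rightarrow> real" where
  "times_sinc b t = t * sinc (t * b)"

definition damped_sin :: "real \<Rightarrow> real \<Rightarrow> real \<Rightarrow> real" where
  "damped_sin a b t = exp (- a * t) * times_sinc b t"

definition damped_cos :: "real \<Rightarrow> real \<Rightarrow> real \<Rightarrow> real" where
  "damped_cos a b t = exp (- a * t) * cos (t * b)"

lemma times_sinc_eq: "times_sinc b t = (if b = 0 then t else sin (t * b) / b)"
  by (simp add: times_sinc_def)

lemma mult_times_sinc: "b * times_sinc b t = sin (t * b)"
  by (simp add: times_sinc_eq)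

lemma times_sinc_0 [simp]: "times_sinc b 0 = 0"
  by (simp add: times_sinc_eq)

lemma times_sinc_diff:
  "times_sinc b (u - h) = cos (h * b) * times_sinc b u - times_sinc b h * cos (u * b)"
  unfolding times_sinc_eq
  by (simp add: left_diff_distrib sin_diff diff_divide_distrib mult.commute right_diff_distrib)

lemma damped_sin_shift:
  "damped_sin a b t = (exp (a * h) * cos (h * b)) * damped_sin a b (t + h)
    + (- (exp (a * h) * times_sinc b h)) * damped_cos a b (t + h)"
proof -
  have e: "exp (- a * t) = exp (a * h) * exp (- a * (t + h))"
    by (simp add: algebra_simps flip: exp_add)
  have "times_sinc b t
      = cos (h * b) * times_sinc b (t + h) - times_sinc b h * cos ((t + h) * b)"
    using times_sinc_diff[of b "t + h" h] by simp
  then show ?thesis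
    unfolding damped_sin_def damped_cos_def e by (simp only:) (simp add: algebra_simps)
qed

lemma damped_cos_shift:
  "damped_cos a b t = (exp (a * h) * cos (h * b)) * damped_cos a b (t + h)
    + (b\<^sup>2 * (exp (a * h) * times_sinc b h)) * damped_sin a b (t + h)"
proof -
  have e: "exp (- a * t) = exp (a * h) * exp (- a * (t + h))"
    by (simp add: algebra_simps flip: exp_add)
  have "cos (t * b) = cos ((t + h) * b) * cos (h * b) + sin ((t + h) * b) * sin (h * b)"
    using cos_diff[of "(t + h) * b" "h * b"] by (simp add: distrib_right)
  then have "cos (t * b) = cos (h * b) * cos ((t + h) * b)
      + b\<^sup>2 * times_sinc b h * times_sinc b (t + h)"
    by (simp add: power2_eq_square flip: mult_times_sinc)
  then show ?thesis
    unfolding damped_sin_def damped_cos_def e by (simp only:) (simp add: algebra_simps)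
qed

lemma times_sinc_has_derivative:
  "(times_sinc b has_real_derivative cos (t * b)) (at t)"
  unfolding times_sinc_eq[abs_def] by (cases "b = 0") (auto intro!: derivative_eq_intros)

lemma damped_sin_has_derivative:
  "(damped_sin a b has_real_derivative damped_cos a b t - a * damped_sin a b t) (at t)"
proof -
  have "((\<lambda>t. exp (- a * t) * times_sinc b t) has_real_derivative
      - a * exp (- a * t) * times_sinc b t + cos (t * b) * exp (- a * t)) (at t)"
    by (intro DERIV_mult times_sinc_has_derivative) (auto intro!: derivative_eq_intros)
  then show ?thesis
    by (simp add: damped_sin_def[abs_def] damped_cos_def[abs_def] algebra_simps)
qed

lemma abs_times_sinc_le: "\<bar>times_sinc b t\<bar> \<le> \<bar>t\<bar>"
  using abs_sin_x_le_abs_x[of "t * b"] unfolding times_sinc_eq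
  by (simp add: abs_mult divide_le_eq)

context exp_bounded_semigroup
begin

lemma weight_damped_cos: "a > \<omega> \<Longrightarrow> weight (damped_cos a b)"
  unfolding weight_def
  by (intro conjI exI[of _ 1] exI[of _ a])
    (auto simp: damped_cos_def abs_mult mult_left_le intro!: continuous_intros)

text \<open>
  The factor \<open>t\<close> costs a little of the decay: with \<open>c\<close> halfway between \<open>\<omega>\<close> and \<open>a\<close>,
  $t \le e^{(a-c)t}/(a-c)$.
\<close>

lemma weight_damped_sin:
  assumes "a > \<omega>"
  shows "weight (damped_sin a b)"
proof -
  define c where "c = (a + \<omega>) / 2"
  define d where "d = a - c"
  have c: "c > \<omega>" and d: "d > 0" using assms by (auto simp: c_def d_def field_simps)
  have "\<bar>damped_sin a b t\<bar> \<le> (1 / d) * exp (- c * t)" if t: "t \<ge> 0" for t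
  proof -
    have "d * t \<le> exp (d * t)" using exp_ge_add_one_self[of "d * t"] by linarith
    then have "t \<le> exp (d * t) / d" using d by (simp add: field_simps)
    then have "\<bar>times_sinc b t\<bar> \<le> exp (d * t) / d"
      using abs_times_sinc_le[of b t] t by linarith
    then have "\<bar>damped_sin a b t\<bar> \<le> exp (- a * t) * (exp (d * t) / d)"
      unfolding damped_sin_def abs_mult abs_exp_cancel by (rule mult_left_mono) simp
    also have "\<dots> = (1 / d) * exp (- c * t)" by (simp add: d_def algebra_simps flip: exp_add)
    finally show ?thesis .
  qed
  moreover have "continuous_on {0..} (damped_sin a b)"
    by (rule DERIV_continuous_on) (rule has_field_derivative_at_within[OF damped_sin_has_derivative])
  ultimately show ?thesis unfolding weight_def using c by blast
qed

lemma generator_damped_sin: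
  assumes "a > \<omega>"
  shows "orbit_integral (damped_sin a b) x \<in> generator_domain T"
    and "generator T (orbit_integral (damped_sin a b) x) =
      a *\<^sub>R orbit_integral (damped_sin a b) x - orbit_integral (damped_cos a b) x"
proof -
  have d: "((\<lambda>h. exp (a * h) * cos (h * b)) has_real_derivative a) (at 0)"
    by (auto intro!: derivative_eq_intros)
  have "((\<lambda>h. exp (a * h) * times_sinc b h) has_real_derivative
      a * exp (a * 0) * times_sinc b 0 + cos (0 * b) * exp (a * 0)) (at 0)"
    by (intro DERIV_mult times_sinc_has_derivative) (auto intro!: derivative_eq_intros)
  from DERIV_minus[OF this]
  have e: "((\<lambda>h. - (exp (a * h) * times_sinc b h)) has_real_derivative - 1) (at 0)" by simp
  note * = generator_orbit_integral[where \<phi> = "damped_sin a b" and \<psi> = "damped_cos a b" and x = x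
      and \<alpha> = "\<lambda>h. exp (a * h) * cos (h * b)" and \<beta> = "\<lambda>h. - (exp (a * h) * times_sinc b h)",
      OF weight_damped_sin[OF assms] weight_damped_cos[OF assms] damped_sin_shift _ d _ e]
  show "orbit_integral (damped_sin a b) x \<in> generator_domain T"
    by (rule *(1)) auto
  have "generator T (orbit_integral (damped_sin a b) x) =
      a *\<^sub>R orbit_integral (damped_sin a b) x + (- 1) *\<^sub>R orbit_integral (damped_cos a b) x
      - damped_sin a b 0 *\<^sub>R x"
    by (rule *(2)) auto
  then show "generator T (orbit_integral (damped_sin a b) x) =
      a *\<^sub>R orbit_integral (damped_sin a b) x - orbit_integral (damped_cos a b) x"
    by (simp add: damped_sin_def)
qed

lemma generator_damped_cos:
  assumes "a > \<omega>"
  shows "orbit_integral (damped_cos a b) x \<in> generator_domain T"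
    and "generator T (orbit_integral (damped_cos a b) x) =
      a *\<^sub>R orbit_integral (damped_cos a b) x + b\<^sup>2 *\<^sub>R orbit_integral (damped_sin a b) x - x"
proof -
  have d: "((\<lambda>h. exp (a * h) * cos (h * b)) has_real_derivative a) (at 0)"
    by (auto intro!: derivative_eq_intros)
  have "((\<lambda>h. exp (a * h) * times_sinc b h) has_real_derivative
      a * exp (a * 0) * times_sinc b 0 + cos (0 * b) * exp (a * 0)) (at 0)"
    by (intro DERIV_mult times_sinc_has_derivative) (auto intro!: derivative_eq_intros)
  from DERIV_cmult[OF this, of "b\<^sup>2"]
  have e: "((\<lambda>h. b\<^sup>2 * (exp (a * h) * times_sinc b h)) has_real_derivative b\<^sup>2) (at 0)" by simp
  note * = generator_orbit_integral[where \<phi> = "damped_cos a b" and \<psi> = "damped_sin a b" and x = x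
      and \<alpha> = "\<lambda>h. exp (a * h) * cos (h * b)" and \<beta> = "\<lambda>h. b\<^sup>2 * (exp (a * h) * times_sinc b h)",
      OF weight_damped_cos[OF assms] weight_damped_sin[OF assms] damped_cos_shift _ d _ e]
  show "orbit_integral (damped_cos a b) x \<in> generator_domain T"
    by (rule *(1)) auto
  have "generator T (orbit_integral (damped_cos a b) x) =
      a *\<^sub>R orbit_integral (damped_cos a b) x + b\<^sup>2 *\<^sub>R orbit_integral (damped_sin a b) x
      - damped_cos a b 0 *\<^sub>R x"
    by (rule *(2)) auto
  then show "generator T (orbit_integral (damped_cos a b) x) =
      a *\<^sub>R orbit_integral (damped_cos a b) x + b\<^sup>2 *\<^sub>R orbit_integral (damped_sin a b) x - x"
    by (simp add: damped_cos_def)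
qed

end

section \<open>The inverse of the quadratic operator\<close>

context exp_bounded_semigroup
begin

text \<open>
  Every integrand of the theorem has the form of \<open>f\<close>, with the two damped oscillations as
  weights; for $e^{-tq}$ the vectors \<open>x\<close> and \<open>y\<close> are $x$ and $\mathbf{j}x$.
\<close>

lemma combined_orbit_integral:
  assumes \<phi>: "weight \<phi>" and \<psi>: "weight \<psi>"
    and f: "\<And>t. t \<ge> 0 \<Longrightarrow> f t = c *\<^sub>R (\<phi> t *\<^sub>R T t x) + d *\<^sub>R (\<psi> t *\<^sub>R T t y)"
  shows "exp_decaying f"
    and "has_improper_integral f (c *\<^sub>R orbit_integral \<phi> x + d *\<^sub>R orbit_integral \<psi> y)"
proof -
  have *: "exp_decaying (\<lambda>t. r *\<^sub>R (\<eta> t *\<^sub>R T t z))"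
    "has_improper_integral (\<lambda>t. r *\<^sub>R (\<eta> t *\<^sub>R T t z)) (r *\<^sub>R orbit_integral \<eta> z)"
    if "weight \<eta>" for r \<eta> z
    using has_improper_integral_linear[OF continuous_weighted_orbit[OF that]
        has_orbit_integral[OF that] bounded_linear_scaleR_right]
      exp_decaying_scaleR[OF exp_decaying_weighted_orbit[OF that]] by blast+
  have cont: "exp_decaying (\<lambda>t. r *\<^sub>R (\<eta> t *\<^sub>R T t z)) \<Longrightarrow>
      continuous_on {0..} (\<lambda>t. r *\<^sub>R (\<eta> t *\<^sub>R T t z))" for r \<eta> z
    by (simp add: exp_decaying_def)
  have "exp_decaying (\<lambda>t. c *\<^sub>R (\<phi> t *\<^sub>R T t x) + d *\<^sub>R (\<psi> t *\<^sub>R T t y))"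
    by (rule exp_decaying_add[OF *(1)[OF \<phi>] *(1)[OF \<psi>]])
  then show "exp_decaying f" by (rule exp_decaying_cong[THEN iffD2, rotated]) (rule f)
  have "has_improper_integral (\<lambda>t. c *\<^sub>R (\<phi> t *\<^sub>R T t x) + d *\<^sub>R (\<psi> t *\<^sub>R T t y))
      (c *\<^sub>R orbit_integral \<phi> x + d *\<^sub>R orbit_integral \<psi> y)"
    by (rule has_improper_integral_add[OF cont[OF *(1)[OF \<phi>]] *(2)[OF \<phi>]
          cont[OF *(1)[OF \<psi>]] *(2)[OF \<psi>]])
  then show "has_improper_integral f (c *\<^sub>R orbit_integral \<phi> x + d *\<^sub>R orbit_integral \<psi> y)"
    by (rule has_improper_integral_cong[THEN iffD2, rotated]) (rule f)
qed

lemma T_commute: "t \<ge> 0 \<Longrightarrow> s \<ge> 0 \<Longrightarrow> T t (T s x) = T s (T t x)"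
  by (metis T_add add.commute)

lemma has_bochner_combined_orbit:
  assumes "weight \<phi>" "weight \<psi>"
    and "\<And>t. t \<ge> 0 \<Longrightarrow> f t = c *\<^sub>R (\<phi> t *\<^sub>R T t x) + d *\<^sub>R (\<psi> t *\<^sub>R T t y)"
  shows "has_bochner (lebesgue_on {0..}) f (c *\<^sub>R orbit_integral \<phi> x + d *\<^sub>R orbit_integral \<psi> y)"
  using combined_orbit_integral[OF assms] by (rule has_improper_integral_imp_has_bochner)

lemma M_times_norm_nonneg: "0 \<le> M * norm (x :: 'x)"
  using norm_T_le[of 0 x] order_trans[OF norm_ge_zero] by fastforce

text \<open>
  As $|S(t)| \le t e^{-at}$, the integrand is at most $M\|x\|\, t e^{-(a-\omega)t}$.
\<close>

lemma norm_damped_sin_integral_le: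
  assumes "a > \<omega>"
  shows "norm (orbit_integral (damped_sin a b) x) \<le> M / (a - \<omega>)\<^sup>2 * norm x"
proof (rule has_improper_integral_norm_le[OF continuous_weighted_orbit has_orbit_integral])
  define d where "d = a - \<omega>"
  have d: "d > 0" using assms by (simp add: d_def)
  define H where "H t = - (M * norm x) * ((t / d + 1 / d\<^sup>2) * exp (- d * t))" for t
  show "weight (damped_sin a b)" using assms by (rule weight_damped_sin)
  then show "weight (damped_sin a b)" .
  show "norm (damped_sin a b t *\<^sub>R T t x) \<le> (M * norm x) * (t * exp (- d * t))" if t: "t \<ge> 0" for t
  proof -
    have "\<bar>damped_sin a b t\<bar> \<le> exp (- a * t) * t"
      using abs_times_sinc_le[of b t] t by (simp add: damped_sin_def abs_mult)
    then have "norm (damped_sin a b t *\<^sub>R T t x) \<le> (exp (- a * t) * t) * (M * exp (\<omega> * t) * norm x)"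
      unfolding norm_scaleR using norm_T_le[OF t] by (rule mult_mono) (use t in auto)
    also have "\<dots> = (M * norm x) * (t * (exp (- a * t) * exp (\<omega> * t)))" by simp
    also have "exp (- a * t) * exp (\<omega> * t) = exp (- d * t)"
      by (simp add: d_def algebra_simps flip: exp_add)
    finally show ?thesis .
  qed
  show "(H has_real_derivative (M * norm x) * (t * exp (- d * t))) (at t)" for t
    unfolding H_def using d
    by (auto intro!: derivative_eq_intros simp: field_simps power2_eq_square)
  show "H t - H 0 \<le> M / (a - \<omega>)\<^sup>2 * norm x" if "t \<ge> 0" for t
  proof -
    have "0 \<le> M * norm x * ((t / d + 1 / d\<^sup>2) * exp (- d * t))"
      using that d by (intro mult_nonneg_nonneg M_times_norm_nonneg) auto
    then show ?thesis by (simp add: H_def d_def)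
  qed
qed

lemma bounded_linear_damped_sin_integral:
  assumes "a > \<omega>"
  shows "bounded_linear (orbit_integral (damped_sin a b))"
  using norm_damped_sin_integral_le[OF assms, of b]
  by (intro bounded_linear_intro[where K = "M / (a - \<omega>)\<^sup>2"] orbit_integral_add
      orbit_integral_scaleR weight_damped_sin assms) (simp add: mult.commute)

text \<open>
  Insert $\mathsf{A}J_S = aJ_S - J_C$ and $\mathsf{A}J_C = aJ_C + b^2J_S - 1$; everything but \<open>x\<close> cancels.
\<close>

lemma damped_sin_integral_right_inverse:
  fixes a b :: real
  assumes "a > \<omega>"
  defines "R \<equiv> orbit_integral (damped_sin a b)" and "A \<equiv> generator T"
  shows "R x \<in> square_domain (generator_domain T) A"
    and "A (A (R x)) - (2 * a) *\<^sub>R A (R x) + (a\<^sup>2 + b\<^sup>2) *\<^sub>R R x = x"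
proof -
  let ?C = "orbit_integral (damped_cos a b)"
  have AR: "A (R x) = a *\<^sub>R R x - ?C x" and RD: "R x \<in> generator_domain T"
    unfolding R_def A_def by (rule generator_damped_sin[OF assms(1)])+
  have AC: "A (?C x) = a *\<^sub>R ?C x + b\<^sup>2 *\<^sub>R R x - x" and CD: "?C x \<in> generator_domain T"
    unfolding R_def A_def by (rule generator_damped_cos[OF assms(1)])+
  from combine_generator[OF RD CD, of a "- 1"]
  have ARD: "a *\<^sub>R R x - ?C x \<in> generator_domain T"
    and AAR: "A (a *\<^sub>R R x - ?C x) = a *\<^sub>R A (R x) - A (?C x)"
    by (simp_all add: A_def)
  show "R x \<in> square_domain (generator_domain T) A"
    using RD ARD by (simp add: square_domain_def AR)
  show "A (A (R x)) - (2 * a) *\<^sub>R A (R x) + (a\<^sup>2 + b\<^sup>2) *\<^sub>R R x = x"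
    unfolding AR AAR AC
    by (simp add: algebra_simps power2_eq_square flip: scaleR_2)
qed

text \<open>
  \<open>R\<close> commutes with \<open>A\<close> on the domain of \<open>A\<close>, so on the domain of $\mathsf{A}^2$ the left inverse
  property follows from the right inverse property.
\<close>

lemma damped_sin_integral_left_inverse:
  fixes a b :: real
  assumes a: "a > \<omega>" and x: "x \<in> square_domain (generator_domain T) (generator T)"
  defines "R \<equiv> orbit_integral (damped_sin a b)" and "A \<equiv> generator T"
  shows "R (A (A x) - (2 * a) *\<^sub>R A x + (a\<^sup>2 + b\<^sup>2) *\<^sub>R x) = x"
proof -
  have R: "bounded_linear R" unfolding R_def using a by (rule bounded_linear_damped_sin_integral)
  have comm: "A (R y) = R (A y)" if "y \<in> generator_domain T" for y
    unfolding A_def using that R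
  proof (rule generator_commute)
    show "R (T t z) = T t (R z)" if "t \<ge> 0" for t z
      unfolding R_def using that
      by (intro orbit_integral_commute weight_damped_sin a bounded_linear_T)
        (auto intro: T_commute)
  qed
  have "x \<in> generator_domain T" "A x \<in> generator_domain T"
    using x by (auto simp: square_domain_def A_def)
  then have "R (A (A x)) = A (A (R x))" "R (A x) = A (R x)" by (simp_all add: comm)
  then have "R (A (A x) - (2 * a) *\<^sub>R A x + (a\<^sup>2 + b\<^sup>2) *\<^sub>R x)
      = A (A (R x)) - (2 * a) *\<^sub>R A (R x) + (a\<^sup>2 + b\<^sup>2) *\<^sub>R R x"
    using bounded_linear.linear[OF R] by (simp add: linear_add linear_diff linear_cmul)
  also have "\<dots> = x"
    unfolding R_def A_def by (rule damped_sin_integral_right_inverse(2)[OF a])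
  finally show ?thesis .
qed

end

section \<open>The quadratic cone\<close>

text \<open>
  This is the sign in $e_K e_K = \pm 1$ and also the sign by which conjugation acts on $e_K$.  Removing the
  largest element of $K$ removes exactly \<open>card K\<close> of the pairs $l \le k$.
\<close>

lemma cl_sign_self: "cl_sign K K = (-1) ^ (card K * (card K + 1) div 2)"
  for K :: "'n::{finite,linorder} set"
proof (induction "card K" arbitrary: K)
  case 0
  then show ?case by (simp add: cl_sign_def)
next
  case (Suc m)
  then have ne: "K \<noteq> {}" by auto
  define k where "k = Max K"
  define K' where "K' = K - {k}"
  have k: "k \<in> K" and less: "\<And>l. l \<in> K' \<Longrightarrow> l < k"
    using ne by (auto simp: k_def K'_def order.not_eq_order_implies_strict)
  have K: "K = insert k K'" "k \<notin> K'" using k by (auto simp: K'_def)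
  have m: "m = card K'" using Suc(2) K by simp
  have "(\<Prod>l\<in>K. if l \<le> k then -1 else (1::real)) = (-1) ^ card K"
    using less unfolding K(1) by (subst prod.cong[OF refl, of _ _ "\<lambda>_. -1"]) (auto simp: less_imp_le)
  moreover have "(\<Prod>l\<in>K. if l \<le> i then -1 else (1::real)) = (\<Prod>l\<in>K'. if l \<le> i then -1 else 1)"
    if "i \<in> K'" for i
    using less[OF that] K(2) unfolding K(1) by simp
  moreover have "cl_sign K K = (\<Prod>l\<in>K. if l \<le> k then -1 else (1::real))
      * (\<Prod>i\<in>K'. \<Prod>l\<in>K. if l \<le> i then -1 else 1)"
    unfolding cl_sign_def using K(2) by (subst (1) K(1)) (rule prod.insert; simp)
  ultimately have "cl_sign K K = (-1) ^ card K * cl_sign K' K'"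
    by (simp add: cl_sign_def)
  also have "\<dots> = (-1) ^ (card K + card K' * (card K' + 1) div 2)"
    using Suc(1)[OF m] by (simp add: power_add)
  also have "card K + card K' * (card K' + 1) div 2 = card K * (card K + 1) div 2"
  proof -
    have "card K * (card K + 1) = card K' * (card K' + 1) + card K * 2"
      using Suc(2) by (simp flip: m Suc(2))
    then show ?thesis by simp
  qed
  finally show ?case .
qed

text \<open>
  Left multiplication by $e_K$ is a signed permutation of the basis whose square is \<open>cl_sign K K\<close>, so its
  transpose is \<open>cl_sign K K\<close> times itself, which is left multiplication by the conjugate of $e_K$.
\<close>

lemma cl_left_mult_adjoint:
  "cl_coord (q * u) \<bullet> cl_coord v = cl_coord u \<bullet> cl_coord (cl_conj q * v)"
proof -
  have "cl_coord (q * u) \<bullet> cl_coord v = (\<Sum>M\<in>UNIV. \<Sum>K\<in>UNIV.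
      cl_sign K (sym_diff K M) * cl_coord q $ K * cl_coord u $ sym_diff K M * cl_coord v $ M)"
    by (simp add: inner_vec_def cl_coord_times sum_distrib_right)
  also have "\<dots> = (\<Sum>K\<in>UNIV. \<Sum>M\<in>UNIV.
      cl_sign K (sym_diff K M) * cl_coord q $ K * cl_coord u $ sym_diff K M * cl_coord v $ M)"
    by (rule sum.swap)
  also have "\<dots> = (\<Sum>K\<in>UNIV. \<Sum>L\<in>UNIV.
      cl_sign K L * cl_coord q $ K * cl_coord u $ L * cl_coord v $ sym_diff K L)"
  proof (rule sum.cong[OF refl])
    fix K :: "'a set"
    have s: "sym_diff K (sym_diff K B) = B" for B by auto
    show "(\<Sum>M\<in>UNIV. cl_sign K (sym_diff K M) * cl_coord q $ K * cl_coord u $ sym_diff K M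
        * cl_coord v $ M)
      = (\<Sum>L\<in>UNIV. cl_sign K L * cl_coord q $ K * cl_coord u $ L * cl_coord v $ sym_diff K L)"
      by (rule sum.reindex_bij_witness[where i = "sym_diff K" and j = "sym_diff K"])
        (simp_all only: s UNIV_I)
  qed
  also have "\<dots> = (\<Sum>K\<in>UNIV. \<Sum>L\<in>UNIV. cl_sign K (sym_diff K L) * cl_coord (cl_conj q) $ K
      * cl_coord u $ L * cl_coord v $ sym_diff K L)"
  proof (intro sum.cong refl)
    fix K L :: "'a set"
    have "cl_sign K (sym_diff K L) * cl_coord (cl_conj q) $ K
        = (cl_sign K K * cl_sign K K) * (cl_sign K L * cl_coord q $ K)"
      unfolding cl_sign_sym_diff_right cl_coord_conj cl_sign_self[symmetric]
      by (simp only: mult_ac)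
    then show "cl_sign K L * cl_coord q $ K * cl_coord u $ L * cl_coord v $ sym_diff K L
      = cl_sign K (sym_diff K L) * cl_coord (cl_conj q) $ K * cl_coord u $ L
        * cl_coord v $ sym_diff K L"
      by (simp add: cl_sign_square)
  qed
  also have "\<dots> = (\<Sum>L\<in>UNIV. \<Sum>K\<in>UNIV. cl_sign K (sym_diff K L) * cl_coord (cl_conj q) $ K
      * cl_coord u $ L * cl_coord v $ sym_diff K L)"
    by (rule sum.swap)
  also have "\<dots> = cl_coord u \<bullet> cl_coord (cl_conj q * v)"
    by (simp only: inner_vec_def cl_coord_times sum_distrib_left inner_real_def mult_ac)
  finally show ?thesis .
qed

text \<open>
  By adjointness $|qu|^2 = \langle u, q^c q u\rangle = r^2|u|^2$ for the Euclidean norm.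
\<close>

lemma norm_clifford_if_conj_mult:
  fixes q :: "'n::{finite,linorder} clifford"
  assumes "cl_conj q * q = of_real (r\<^sup>2)" "r \<ge> 0"
  shows "norm q = r"
proof -
  have *: "norm (cl_coord (q * u)) = r * norm (cl_coord u)" for u
  proof -
    have "(norm (cl_coord (q * u)))\<^sup>2 = cl_coord u \<bullet> cl_coord (cl_conj q * (q * u))"
      by (simp add: power2_norm_eq_inner cl_left_mult_adjoint)
    also have "cl_conj q * (q * u) = r\<^sup>2 *\<^sub>R u"
      by (simp add: assms(1) of_real_def flip: mult.assoc)
    also have "cl_coord u \<bullet> cl_coord (r\<^sup>2 *\<^sub>R u) = (r * norm (cl_coord u))\<^sup>2"
      by (simp add: power_mult_distrib power2_norm_eq_inner)
    finally show ?thesis using assms(2) by simp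
  qed
  have "norm q \<le> r"
    unfolding norm_clifford_def by (rule cl_norm_least) (simp add: *)
  moreover have "r \<le> norm q"
    using cl_norm_bound[of q 1] *[of 1] by (simp add: norm_clifford_def)
  ultimately show ?thesis by simp
qed

lemma cl_conj_add: "cl_conj (p + q) = cl_conj p + cl_conj q"
  by (simp add: clifford_eq_iff cl_coord_conj algebra_simps)

lemma cl_conj_scaleR: "cl_conj (r *\<^sub>R q) = r *\<^sub>R cl_conj q"
  by (simp add: clifford_eq_iff cl_coord_conj)

lemma cl_conj_of_real: "cl_conj (of_real r :: 'n::{finite,linorder} clifford) = of_real r"
  by (simp add: clifford_eq_iff cl_coord_conj of_real_def axis_def)

lemma cl_conj_plane:
  assumes "j \<in> cl_imag_units"
  shows "cl_conj (of_real r + s *\<^sub>R j) = of_real r - s *\<^sub>R j"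
  using assms by (simp add: cl_conj_add cl_conj_scaleR cl_conj_of_real cl_imag_units_def)

lemma norm_plane:
  assumes "j \<in> cl_imag_units"
  shows "norm (of_real r + s *\<^sub>R j) = sqrt (r\<^sup>2 + s\<^sup>2)"
proof (rule norm_clifford_if_conj_mult)
  have jj: "j * j = -1" using assms by (simp add: cl_imag_units_def power2_eq_square)
  show "cl_conj (of_real r + s *\<^sub>R j) * (of_real r + s *\<^sub>R j) = of_real ((sqrt (r\<^sup>2 + s\<^sup>2))\<^sup>2)"
    unfolding cl_conj_plane[OF assms] by (simp add: algebra_simps jj of_real_def power2_eq_square)
qed simp

text \<open>
  Euler's formula in the plane of \<open>j\<close>: the product $e^{s\mathbf{j}}(\cos s - \mathbf{j}\sin s)$ has zero
  derivative, and $\cos s + \mathbf{j}\sin s$ inverts the second factor.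
\<close>

lemma exp_plane:
  fixes j :: "'n::{finite,linorder} clifford"
  assumes "j \<in> cl_imag_units"
  shows "exp (of_real r + s *\<^sub>R j) = of_real (exp r * cos s) + (exp r * sin s) *\<^sub>R j"
proof -
  have jj: "j * j = -1" using assms by (simp add: cl_imag_units_def power2_eq_square)
  define F where "F s = exp (s *\<^sub>R j) * (of_real (cos s) - sin s *\<^sub>R j)" for s
  have "(F has_vector_derivative 0) (at s)" for s
  proof -
    have "((\<lambda>s. of_real (cos s) - sin s *\<^sub>R j) has_vector_derivative
        of_real (- sin s) - cos s *\<^sub>R j) (at s)"
    proof -
      have "((\<lambda>s. cos s *\<^sub>R (1::'n clifford)) has_vector_derivative
          cos s *\<^sub>R 0 + (- sin s) *\<^sub>R 1) (at s)"
        by (intro has_vector_derivative_scaleR has_vector_derivative_const)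
          (auto intro!: derivative_eq_intros)
      moreover have "((\<lambda>s. sin s *\<^sub>R j) has_vector_derivative sin s *\<^sub>R 0 + cos s *\<^sub>R j) (at s)"
        by (intro has_vector_derivative_scaleR has_vector_derivative_const)
          (auto intro!: derivative_eq_intros)
      ultimately have "((\<lambda>s. cos s *\<^sub>R (1::'n clifford) - sin s *\<^sub>R j) has_vector_derivative
          (cos s *\<^sub>R 0 + (- sin s) *\<^sub>R 1) - (sin s *\<^sub>R 0 + cos s *\<^sub>R j)) (at s)"
        by (rule has_vector_derivative_diff)
      then show ?thesis by (simp add: of_real_def)
    qed
    then have "(F has_vector_derivative
        exp (s *\<^sub>R j) * (of_real (- sin s) - cos s *\<^sub>R j)
        + exp (s *\<^sub>R j) * j * (of_real (cos s) - sin s *\<^sub>R j)) (at s)"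
      unfolding F_def
      by (rule has_vector_derivative_mult[OF exp_scaleR_has_vector_derivative_right])
    moreover have "exp (s *\<^sub>R j) * (of_real (- sin s) - cos s *\<^sub>R j)
        + exp (s *\<^sub>R j) * j * (of_real (cos s) - sin s *\<^sub>R j) = 0"
      by (simp add: algebra_simps of_real_def jj)
    ultimately show ?thesis by simp
  qed
  then obtain k where k: "\<And>s. F s = k"
    using has_vector_derivative_zero_constant[of UNIV F] by auto
  have "k = 1" using k[of 0] by (simp add: F_def)
  have "exp (s *\<^sub>R j) = exp (s *\<^sub>R j) * ((of_real (cos s) - sin s *\<^sub>R j) * (of_real (cos s) + sin s *\<^sub>R j))"
  proof -
    have "(of_real (cos s) - sin s *\<^sub>R j) * (of_real (cos s) + sin s *\<^sub>R j)
        = (cos s * cos s) *\<^sub>R 1 + (sin s * sin s) *\<^sub>R 1"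
      by (simp add: algebra_simps jj of_real_def)
    also have "\<dots> = (cos s * cos s + sin s * sin s) *\<^sub>R 1"
      by (rule scaleR_left_distrib[symmetric])
    finally show ?thesis by simp
  qed
  also have "\<dots> = F s * (of_real (cos s) + sin s *\<^sub>R j)"
    by (simp add: F_def mult.assoc)
  finally have "exp (s *\<^sub>R j) = of_real (cos s) + sin s *\<^sub>R j"
    by (simp add: k \<open>k = 1\<close>)
  moreover have "exp (of_real r + s *\<^sub>R j) = exp (of_real r) * exp (s *\<^sub>R j)"
    by (rule exp_add_commuting) (simp add: of_real_def)
  ultimately show ?thesis
    unfolding exp_of_real by (simp add: distrib_left of_real_def mult.commute[of "exp r"])
qed

lemma cl_coneE:
  assumes "q \<in> cl_cone"
  obtains s j where "j \<in> cl_imag_units" "q = of_real (cl_re q) + s *\<^sub>R j" "norm (cl_Im q) = \<bar>s\<bar>"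
    "(norm q)\<^sup>2 = (cl_re q)\<^sup>2 + s\<^sup>2"
proof -
  obtain j r s where j: "j \<in> cl_imag_units" and q: "q = of_real r + s *\<^sub>R j"
    using assms by (auto simp: cl_cone_def cl_plane_def of_real_def)
  have "cl_Re q = of_real r"
    unfolding cl_Re_def q cl_conj_plane[OF j] by (simp add: of_real_def flip: scaleR_add_left)
  then have "cl_re q = r" by (simp add: cl_re_def of_real_def)
  moreover have "cl_Im q = of_real 0 + s *\<^sub>R j"
    unfolding cl_Im_def q cl_conj_plane[OF j] by (simp add: flip: scaleR_add_left)
  then have "norm (cl_Im q) = \<bar>s\<bar>" by (simp only: norm_plane[OF j]) simp
  moreover have "(norm q)\<^sup>2 = r\<^sup>2 + s\<^sup>2" unfolding q norm_plane[OF j] by simp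
  ultimately show ?thesis using j q by (intro that) auto
qed

section \<open>Right linear operators\<close>

context banach_bimodule
begin

lemma lscale_scaleR_left: "lscale (r *\<^sub>R p) x = r *\<^sub>R lscale p x"
  using lscale_lscale[of "of_real r" p x] by (simp add: lscale_scaleR scaleR_conv_of_real)

lemma bounded_linear_lscale: "bounded_linear (lscale p)"
proof (rule bounded_linear_intro)
  show "lscale p (r *\<^sub>R x) = r *\<^sub>R lscale p x" for r x
  proof -
    have "p * of_real r = r *\<^sub>R p" by (simp add: of_real_def)
    then show ?thesis
      using lscale_lscale[of p "of_real r" x] by (simp add: lscale_scaleR lscale_scaleR_left)
  qed
  show "norm (lscale p x) \<le> norm x * norm p" for x
    using norm_lscale_le[of p x] by (simp add: mult.commute)
qed (rule lscale_add_right)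

lemma bounded_linear_rscale: "bounded_linear (\<lambda>x. rscale x p)"
proof (rule bounded_linear_intro)
  show "rscale (r *\<^sub>R x) p = r *\<^sub>R rscale x p" for r x
    using lscale_rscale[of "of_real r" x p] by (simp add: lscale_scaleR)
  show "norm (rscale x p) \<le> norm x * norm p" for x
    using norm_rscale_le[of x p] by (simp add: mult.commute)
qed (rule rscale_add_left)

text \<open>
  Real homogeneity is right linearity with respect to the real scalars.
\<close>

lemma bounded_right_linear_imp_bounded_linear:
  assumes "B \<in> bounded_right_linear rscale"
  shows "bounded_linear B"
proof -
  have add: "B (x + y) = B x + B y" and rs: "B (rscale x p) = rscale (B x) p" for x y p
    using assms by (auto simp: bounded_right_linear_def right_linear_def)
  have scale: "B (r *\<^sub>R x) = r *\<^sub>R B x" for r x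
    using rs[of x "of_real r"] by (simp add: lscale_scaleR flip: lscale_of_real)
  obtain K where K: "\<And>x. x \<noteq> 0 \<Longrightarrow> norm (B x) / norm x \<le> K"
    using assms by (auto simp: bounded_right_linear_def bdd_above_def)
  have "norm (B x) \<le> norm x * K" for x
  proof (cases "x = 0")
    case True
    then show ?thesis using scale[of 0 x] by simp
  next
    case False
    then show ?thesis using K[OF False] by (simp add: divide_le_eq mult.commute)
  qed
  with add scale show ?thesis by (intro bounded_linear_intro)
qed

lemma bounded_right_linearI:
  assumes "bounded_linear B" "\<And>x p. B (rscale x p) = rscale (B x) p"
  shows "B \<in> bounded_right_linear rscale"
proof -
  have "norm (B x) / norm x \<le> onorm B" for x by (rule le_onorm[OF assms(1)])
  then show ?thesis
    using assms(2) linear_add[OF bounded_linear.linear[OF assms(1)]]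
    by (auto simp: bounded_right_linear_def right_linear_def intro!: bdd_aboveI[where M = "onorm B"])
qed

text \<open>
  The semigroup law is assumed for positive times only; at time \<open>0\<close> it follows from \<open>T 0 = id\<close>.
\<close>

lemma sc_semigroup_exp_bounded:
  assumes T: "sc_semigroup rscale T"
    and bdd: "bdd_above ((\<lambda>t. onorm (T t) * exp (- \<omega> * t)) ` {0..})"
    and M: "M = (SUP t\<in>{0..}. onorm (T t) * exp (- \<omega> * t))"
  shows "exp_bounded_semigroup T M \<omega>"
proof (rule exp_bounded_semigroup.intro)
  show bl: "bounded_linear (T t)" if "t \<ge> 0" for t
    using T that by (auto simp: sc_semigroup_def intro: bounded_right_linear_imp_bounded_linear)
  show "continuous_on {0..} (\<lambda>t. T t x)" for x using T by (auto simp: sc_semigroup_def)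
  show T0: "T 0 x = x" for x using T by (auto simp: sc_semigroup_def)
  show "T (t + s) x = T t (T s x)" if "t \<ge> 0" "s \<ge> 0" for t s x
    using T that by (cases "t = 0 \<or> s = 0") (auto simp: T0 sc_semigroup_def)
  show "norm (T t x) \<le> M * exp (\<omega> * t) * norm x" if t: "t \<ge> 0" for t x
  proof -
    have "onorm (T t) * exp (- \<omega> * t) \<le> M"
      unfolding M using t bdd by (intro cSUP_upper) auto
    then have "onorm (T t) \<le> M * exp (\<omega> * t)" by (simp add: exp_minus field_simps)
    then show ?thesis
      using onorm[OF bl[OF t], of x] by (meson mult_right_mono norm_ge_zero order_trans)
  qed
qed

end

section \<open>The spherical resolvents of the generator\<close>

theorem theorem1p2:
  fixes lscale :: "'n::{finite,linorder} clifford \<Rightarrow> 'x::banach \<Rightarrow> 'x"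
    and rscale :: "'x \<Rightarrow> 'n clifford \<Rightarrow> 'x"
    and T :: "real \<Rightarrow> 'x \<Rightarrow> 'x" and D :: "'x set" and A :: "'x \<Rightarrow> 'x"
    and \<omega> M a b :: real and g :: "real \<Rightarrow> real" and q :: "'n clifford"
    and Q C :: "'x \<Rightarrow> 'x" and L :: "real measure"
  assumes "banach_bimodule lscale rscale"
    and "sc_semigroup rscale T"
    and D: "D = generator_domain T" and A: "A = generator T"
    and "bdd_above ((\<lambda>t. onorm (T t) * exp (- \<omega> * t)) ` {0..})"
    and M: "M = (SUP t\<in>{0..}. onorm (T t) * exp (- \<omega> * t))"
    and "q \<in> cl_cone"
    and a: "a = cl_re q" and b: "b = norm (cl_Im q)"
    and g: "g = (\<lambda>t. t * exp (- a * t) * sinc (t * b))"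
    and "cl_re q > \<omega>"
    and Q: "Q = quasi_resolvent D A q"
    and C: "C = sph_resolvent lscale D A q"
    and L: "L = lebesgue_on {0..}"
  shows "q \<in> sph_resolvent_set rscale D A \<and>
    (\<forall>x.
      has_bochner L (\<lambda>t. op_scale lscale (T t) (of_real (g t)) x) (Q x) \<and>
      has_bochner L (\<lambda>t. op_scale lscale (T t)
        (of_real (t * exp (- t * a) * sinc (t * b))) x) (Q x) \<and>
      has_bochner L (\<lambda>t. op_scale lscale (T t) (of_real (deriv g t)) x) (- A (Q x)) \<and>
      has_bochner L (\<lambda>t. op_scale lscale (T t)
        (of_real (exp (- t * a) * (cos (t * b) - a * t * sinc (t * b)))) x) (- A (Q x)) \<and>
      has_bochner L (\<lambda>t. op_scale lscale (T t) (exp (- (t *\<^sub>R q))) x) (C x)) \<and>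
    onorm Q \<le> M / (cl_re q - \<omega>)\<^sup>2 \<and>
    C \<in> bounded_right_linear rscale \<and> onorm C \<le> M / (cl_re q - \<omega>)"
proof -
  interpret banach_bimodule lscale rscale by fact
  interpret exp_bounded_semigroup T M \<omega>
    using assms(2,5) M by (rule sc_semigroup_exp_bounded)
  define S where "S = orbit_integral (damped_sin a b)"
  define K where "K = orbit_integral (damped_cos a b)"
  have a\<omega>: "a > \<omega>" using \<open>cl_re q > \<omega>\<close> a by simp
  note ws = weight_damped_sin[OF a\<omega>, of b] and wc = weight_damped_cos[OF a\<omega>, of b]
  obtain j s where j: "j \<in> cl_imag_units" and q: "q = of_real a + s *\<^sub>R j" and b_s: "b = \<bar>s\<bar>"
    and norm_q: "(norm q)\<^sup>2 = a\<^sup>2 + b\<^sup>2"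
    using cl_coneE[OF \<open>q \<in> cl_cone\<close>] a b by (metis power2_abs)
  have S_bl: "bounded_linear S"
    unfolding S_def using a\<omega> by (rule bounded_linear_damped_sin_integral)
  have T_rscale: "T t (rscale x p) = rscale (T t x) p" if "t \<ge> 0" for t x p
    using \<open>sc_semigroup rscale T\<close> that
    by (auto simp: sc_semigroup_def bounded_right_linear_def right_linear_def)
  have orbit_rscale: "orbit_integral \<phi> (rscale x p) = rscale (orbit_integral \<phi> x) p"
    if "weight \<phi>" for \<phi> x p
    using that bounded_linear_rscale T_rscale by (intro orbit_integral_commute) auto

  have Delta: "sph_Delta A q x = A (A x) - (2 * a) *\<^sub>R A x + (a\<^sup>2 + b\<^sup>2) *\<^sub>R x" for x
    by (simp add: sph_Delta_def norm_q flip: a)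
  have S_dom: "S x \<in> square_domain D A" and Delta_S: "sph_Delta A q (S x) = x" for x
    unfolding Delta unfolding S_def D A
    using damped_sin_integral_right_inverse[OF a\<omega>] by blast+
  have S_Delta: "S (sph_Delta A q x) = x" if "x \<in> square_domain D A" for x
    unfolding Delta unfolding S_def A
    using that damped_sin_integral_left_inverse[OF a\<omega>] by (simp add: D A)
  have bij: "bij_betw (sph_Delta A q) (square_domain D A) UNIV"
    by (rule bij_betw_byWitness[where f' = S]) (use S_dom Delta_S S_Delta in auto)
  have Q_S: "Q = S"
  proof
    fix x
    show "Q x = S x"
      unfolding Q quasi_resolvent_def
      by (rule inv_into_f_eq[OF bij_betw_imp_inj_on[OF bij] S_dom Delta_S])
  qed
  have Q_right: "Q \<in> bounded_right_linear rscale"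
    unfolding Q_S using S_bl by (rule bounded_right_linearI) (simp add: S_def orbit_rscale ws)
  have resolvent: "q \<in> sph_resolvent_set rscale D A"
    using \<open>q \<in> cl_cone\<close> bij Q_right by (simp add: sph_resolvent_set_def Q)
  have AQ: "A (Q x) = a *\<^sub>R S x - K x" for x
    unfolding Q_S A S_def K_def by (rule generator_damped_sin[OF a\<omega>])

  \<comment> \<open>The multiples of \<open>S x\<close> in $\mathsf{Q}_q(\mathsf{A})q^c x$ and $\mathsf{A}\mathsf{Q}_q(\mathsf{A})x$ cancel.\<close>
  have C_eq: "C x = K x - s *\<^sub>R S (lscale j x)" for x
  proof -
    have "lscale (cl_conj q) x = a *\<^sub>R x - s *\<^sub>R lscale j x"
      unfolding q cl_conj_plane[OF j]
      using lscale_add_left[of "of_real a" "(- s) *\<^sub>R j" x]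
      by (simp add: lscale_scaleR lscale_scaleR_left del: scaleR_minus_left)
        (simp add: lscale_scaleR_left)
    then have "S (lscale (cl_conj q) x) = a *\<^sub>R S x - s *\<^sub>R S (lscale j x)"
      by (simp add: linear_diff linear_cmul bounded_linear.linear[OF S_bl])
    then show ?thesis
      unfolding C sph_resolvent_def op_scale_def
      using AQ[of x] by (simp add: Q_S flip: Q)
  qed
  have C_integrand: "T t (lscale (exp (- (t *\<^sub>R q))) x)
      = 1 *\<^sub>R (damped_cos a b t *\<^sub>R T t x) + (- s) *\<^sub>R (damped_sin a b t *\<^sub>R T t (lscale j x))"
    if t: "t \<ge> 0" for t x
  proof -
    have "s * times_sinc b t = sin (t * s)"
      by (cases "s \<ge> 0") (simp_all add: times_sinc_eq b_s)
    then have sin: "exp (- a * t) * sin (t * s) = s * damped_sin a b t"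
      by (simp add: damped_sin_def)
    have cos: "exp (- a * t) * cos (t * s) = damped_cos a b t"
      by (cases "s \<ge> 0") (simp_all add: damped_cos_def b_s)
    have "- (t *\<^sub>R q) = of_real (- a * t) + (- (t * s)) *\<^sub>R j"
      by (simp add: q of_real_def scaleR_add_right mult.commute)
    then have "exp (- (t *\<^sub>R q)) = of_real (exp (- a * t) * cos (t * s))
        + (- (exp (- a * t) * sin (t * s))) *\<^sub>R j"
      using exp_plane[OF j, of "- a * t" "- (t * s)"] by simp
    then have "lscale (exp (- (t *\<^sub>R q))) x
        = damped_cos a b t *\<^sub>R x + (- (s * damped_sin a b t)) *\<^sub>R lscale j x"
      unfolding sin cos by (simp only: lscale_add_left lscale_scaleR lscale_scaleR_left)
    then have "T t (lscale (exp (- (t *\<^sub>R q))) x)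
        = damped_cos a b t *\<^sub>R T t x + (- (s * damped_sin a b t)) *\<^sub>R T t (lscale j x)"
      by (simp only: T_plus[OF t] T_scaleR[OF t])
    then show ?thesis by simp
  qed
  have norm_exp: "norm (exp (- (t *\<^sub>R q))) = exp (- a * t)" for t
  proof -
    have "- (t *\<^sub>R q) = of_real (- a * t) + (- (t * s)) *\<^sub>R j"
      by (simp add: q of_real_def scaleR_add_right mult.commute)
    then have "norm (exp (- (t *\<^sub>R q)))
        = sqrt ((exp (- a * t) * cos (- (t * s)))\<^sup>2 + (exp (- a * t) * sin (- (t * s)))\<^sup>2)"
      by (simp only: exp_plane[OF j] norm_plane[OF j])
    also have "\<dots> = sqrt ((exp (- a * t))\<^sup>2)"
      by (simp add: power_mult_distrib flip: distrib_left)
    finally show ?thesis by simp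
  qed
  have C_integral: "has_improper_integral (\<lambda>t. T t (lscale (exp (- (t *\<^sub>R q))) x)) (C x)"
    and C_decay: "exp_decaying (\<lambda>t. T t (lscale (exp (- (t *\<^sub>R q))) x))" for x
    using combined_orbit_integral[OF wc ws C_integrand] by (simp_all add: C_eq K_def S_def)

  have bochner: "has_bochner L (\<lambda>t. op_scale lscale (T t) (of_real (\<phi> t)) x) (c *\<^sub>R K x + d *\<^sub>R S x)"
    if \<phi>: "\<And>t. \<phi> t = c * damped_cos a b t + d * damped_sin a b t" for \<phi> c d x
    unfolding L K_def S_def
    by (rule has_bochner_combined_orbit[OF wc ws])
      (simp only: op_scale_def lscale_scaleR \<phi> T_plus T_scaleR scaleR_add_left scaleR_scaleR)
  have g_eq: "g = damped_sin a b"
    unfolding g by (simp only: damped_sin_def times_sinc_def mult_ac fun_eq_iff) simp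
  have g': "deriv g t = damped_cos a b t - a * damped_sin a b t" for t
    unfolding g_eq by (rule DERIV_imp_deriv[OF damped_sin_has_derivative])
  have sinc_form: "t * exp (- t * a) * sinc (t * b) = damped_sin a b t"
    and cos_form: "exp (- t * a) * (cos (t * b) - a * t * sinc (t * b))
      = damped_cos a b t - a * damped_sin a b t" for t
    by (simp_all add: damped_sin_def damped_cos_def times_sinc_def algebra_simps)
  have integrals: "has_bochner L (\<lambda>t. op_scale lscale (T t) (of_real (g t)) x) (Q x) \<and>
      has_bochner L (\<lambda>t. op_scale lscale (T t)
        (of_real (t * exp (- t * a) * sinc (t * b))) x) (Q x) \<and>
      has_bochner L (\<lambda>t. op_scale lscale (T t) (of_real (deriv g t)) x) (- A (Q x)) \<and>
      has_bochner L (\<lambda>t. op_scale lscale (T t)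
        (of_real (exp (- t * a) * (cos (t * b) - a * t * sinc (t * b)))) x) (- A (Q x)) \<and>
      has_bochner L (\<lambda>t. op_scale lscale (T t) (exp (- (t *\<^sub>R q))) x) (C x)" for x
  proof -
    have "has_bochner L (\<lambda>t. op_scale lscale (T t) (of_real (damped_sin a b t)) x) (Q x)"
      using bochner[of "damped_sin a b" 0 1 x] by (simp add: Q_S)
    moreover have "has_bochner L (\<lambda>t. op_scale lscale (T t)
        (of_real (damped_cos a b t - a * damped_sin a b t)) x) (- A (Q x))"
      using bochner[of "\<lambda>t. damped_cos a b t - a * damped_sin a b t" 1 "- a" x] by (simp add: AQ)
    moreover have "has_bochner L (\<lambda>t. op_scale lscale (T t) (exp (- (t *\<^sub>R q))) x) (C x)"
      unfolding L op_scale_def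
      by (rule has_improper_integral_imp_has_bochner[OF C_decay C_integral])
    ultimately show ?thesis unfolding g' sinc_form cos_form unfolding g_eq by blast
  qed

  have M_nonneg: "0 \<le> M"
  proof -
    have "onorm (T 0) * exp (- \<omega> * 0) \<le> M"
      unfolding M using assms(5) by (rule cSUP_upper[rotated]) simp
    then show ?thesis using onorm_pos_le[OF bounded_linear_T[of 0]] by simp
  qed
  have "onorm Q \<le> M / (a - \<omega>)\<^sup>2"
    unfolding Q_S S_def using M_nonneg norm_damped_sin_integral_le[OF a\<omega>]
    by (intro onorm_bound) auto
  moreover have C_norm: "norm (C x) \<le> M / (a - \<omega>) * norm x" for x
  proof (rule has_improper_integral_norm_le[OF _ C_integral])
    define d where "d = a - \<omega>"
    have d: "d > 0" using a\<omega> by (simp add: d_def)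
    define H where "H t = - (M * norm x / d) * exp (- d * t)" for t
    show "continuous_on {0..} (\<lambda>t. T t (lscale (exp (- (t *\<^sub>R q))) x))"
      using C_decay[of x] by (simp add: exp_decaying_def)
    show "norm (T t (lscale (exp (- (t *\<^sub>R q))) x)) \<le> M * norm x * exp (- d * t)" if t: "t \<ge> 0" for t
    proof -
      have "norm (T t (lscale (exp (- (t *\<^sub>R q))) x))
          \<le> M * exp (\<omega> * t) * norm (lscale (exp (- (t *\<^sub>R q))) x)"
        by (rule norm_T_le[OF t])
      also have "\<dots> \<le> M * exp (\<omega> * t) * (exp (- a * t) * norm x)"
        using norm_lscale_le[of "exp (- (t *\<^sub>R q))" x] M_nonneg
        unfolding norm_exp by (intro mult_left_mono) auto
      also have "\<dots> = M * norm x * (exp (\<omega> * t) * exp (- a * t))" by simp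
      also have "exp (\<omega> * t) * exp (- a * t) = exp (- d * t)"
        by (simp add: d_def algebra_simps flip: exp_add)
      finally show ?thesis .
    qed
    show "(H has_real_derivative M * norm x * exp (- d * t)) (at t)" for t
      unfolding H_def using d by (auto intro!: derivative_eq_intros)
    show "H t - H 0 \<le> M / (a - \<omega>) * norm x" for t
      using d M_nonneg by (simp add: H_def d_def)
  qed
  have C_bl: "bounded_linear C"
  proof (rule bounded_linear_intro)
    show "C (x + y) = C x + C y" for x y
      by (simp add: C_eq K_def S_def orbit_integral_add ws wc lscale_add_right scaleR_add_right)
    show "C (r *\<^sub>R x) = r *\<^sub>R C x" for r x
      by (simp add: C_eq K_def S_def orbit_integral_scaleR ws wc scaleR_diff_right
          linear_cmul[OF bounded_linear.linear[OF bounded_linear_lscale]])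
    show "norm (C x) \<le> norm x * (M / (a - \<omega>))" for x
      using C_norm[of x] by (simp add: mult.commute)
  qed
  have "C \<in> bounded_right_linear rscale"
  proof (rule bounded_right_linearI[OF C_bl])
    show "C (rscale x p) = rscale (C x) p" for x p
      by (simp add: C_eq K_def S_def orbit_rscale ws wc lscale_rscale
          linear_diff[OF bounded_linear.linear[OF bounded_linear_rscale]]
          linear_cmul[OF bounded_linear.linear[OF bounded_linear_rscale]])
  qed
  moreover have "onorm C \<le> M / (a - \<omega>)"
    using C_norm M_nonneg a\<omega> by (intro onorm_bound) auto
  ultimately show ?thesis
    using resolvent integrals unfolding a by blast
qed

end
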